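(* For every $\epsilon>0$ there exists a distributed algorithm in the LOCAL model that, for every outerplanar graph $G$, computes in a constant number of rounds (the constant depending only on $\epsilon$) a dominating set of $G$ of size at most $(8+\epsilon)\gamma(G)$.
   Context: All graphs are finite, undirected and simple. A graph is outerplanar if it has a plane embedding in which all vertices lie on the outer face. In the LOCAL model the input graph is the communication network: each vertex is a processor with a unique identifier; in each synchronous round every vertex may send arbitrary messages to its neighbours and perform arbitrary local computation; at the end each vertex decides whether it belongs to the output set. A dominating set of $G$ is a set $D\subseteq V(G)$ such that every vertex is in $D$ or has a neighbour in $D$; $\gamma(G)$ is the minimum size of a dominating set. *)

theory Defs
  imports "HOL-Analysis.Analysis"
begin

text \<open>Finite simple graphs: vertices are natural numbers, which double as the
  unique identifiers of the processors. E is a symmetric irreflexive relation on V.\<close>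

definition simple_graph :: "nat set \<Rightarrow> (nat \<Rightarrow> nat \<Rightarrow> bool) \<Rightarrow> bool" where
  "simple_graph V E \<longleftrightarrow> finite V \<and>
     (\<forall>u v. E u v \<longrightarrow> u \<in> V \<and> v \<in> V) \<and>
     (\<forall>u v. E u v \<longrightarrow> E v u) \<and> (\<forall>v. \<not> E v v)"

definition drawing :: "nat set \<Rightarrow> (nat \<Rightarrow> nat \<Rightarrow> bool) \<Rightarrow> (nat \<Rightarrow> complex)
    \<Rightarrow> (nat set \<Rightarrow> real \<Rightarrow> complex) \<Rightarrow> complex set" where
  "drawing V E p g = p ` V \<union> (\<Union>{path_image (g {u, v}) | u v. u \<in> V \<and> v \<in> V \<and> E u v})"

definition plane_embedding :: "nat set \<Rightarrow> (nat \<Rightarrow> nat \<Rightarrow> bool) \<Rightarrow> (nat \<Rightarrow> complex)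
    \<Rightarrow> (nat set \<Rightarrow> real \<Rightarrow> complex) \<Rightarrow> bool" where
  "plane_embedding V E p g \<longleftrightarrow>
     inj_on p V \<and>
     (\<forall>u\<in>V. \<forall>v\<in>V. E u v \<longrightarrow>
        arc (g {u, v}) \<and> {pathstart (g {u, v}), pathfinish (g {u, v})} = {p u, p v} \<and>
        path_image (g {u, v}) \<inter> p ` V = {p u, p v}) \<and>
     (\<forall>u\<in>V. \<forall>v\<in>V. \<forall>x\<in>V. \<forall>y\<in>V. E u v \<longrightarrow> E x y \<longrightarrow> {u, v} \<noteq> {x, y} \<longrightarrow>
        path_image (g {u, v}) \<inter> path_image (g {x, y}) \<subseteq> p ` ({u, v} \<inter> {x, y}))"

definition outerplanar :: "nat set \<Rightarrow> (nat \<Rightarrow> nat \<Rightarrow> bool) \<Rightarrow> bool" where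
  "outerplanar V E \<longleftrightarrow>
     (\<exists>p g z. plane_embedding V E p g \<and> z \<notin> drawing V E p g \<and>
        \<not> bounded (connected_component_set (- drawing V E p g) z) \<and>
        (\<forall>v\<in>V. p v \<in> frontier (connected_component_set (- drawing V E p g) z)))"

definition dominating_set :: "nat set \<Rightarrow> (nat \<Rightarrow> nat \<Rightarrow> bool) \<Rightarrow> nat set \<Rightarrow> bool" where
  "dominating_set V E D \<longleftrightarrow> D \<subseteq> V \<and> (\<forall>v\<in>V. v \<in> D \<or> (\<exists>u\<in>D. E v u))"

definition domination_number :: "nat set \<Rightarrow> (nat \<Rightarrow> nat \<Rightarrow> bool) \<Rightarrow> nat" where
  "domination_number V E = Min {card D | D. dominating_set V E D}"

text \<open>LOCAL model. After r rounds a vertex can know at most its radius-r neighbourhood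
  (with identifiers and adjacencies); an r-round algorithm is thus a function that maps the
  view (ball vertex set, induced edge relation, own identifier) to the output bit.\<close>

fun gball :: "nat set \<Rightarrow> (nat \<Rightarrow> nat \<Rightarrow> bool) \<Rightarrow> nat \<Rightarrow> nat \<Rightarrow> nat set" where
  "gball V E v 0 = {v}"
| "gball V E v (Suc r) = gball V E v r \<union> {u \<in> V. \<exists>w \<in> gball V E v r. E w u}"

definition local_view :: "nat set \<Rightarrow> (nat \<Rightarrow> nat \<Rightarrow> bool) \<Rightarrow> nat \<Rightarrow> nat
    \<Rightarrow> nat set \<times> (nat \<Rightarrow> nat \<Rightarrow> bool) \<times> nat" where
  "local_view V E r v =
     (gball V E v r, (\<lambda>x y. x \<in> gball V E v r \<and> y \<in> gball V E v r \<and> E x y), v)"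

definition local_output :: "(nat set \<times> (nat \<Rightarrow> nat \<Rightarrow> bool) \<times> nat \<Rightarrow> bool) \<Rightarrow> nat
    \<Rightarrow> nat set \<Rightarrow> (nat \<Rightarrow> nat \<Rightarrow> bool) \<Rightarrow> nat set" where
  "local_output A r V E = {v \<in> V. A (local_view V E r v)}"

end

theory Submission
  imports Defs
begin

text \<open>
  Call a vertex heavy if no two other vertices dominate its neighbourhood. The algorithm selects all
  heavy vertices and all vertices without a heavy vertex in their closed neighbourhood; three rounds
  suffice, and the selected set has size at most \<open>8 \<gamma>\<close>, for every \<open>\<epsilon>\<close>.

  By a theta-curve argument an outerplanar graph has no K23 minor. Assign every vertex to a dominator
  in an optimal set \<open>D\<close>; the bags are stars, and contracting them gives a K23-minor-free graph on \<open>D\<close>,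
  hence with at most \<open>2 |D|\<close> edges. A heavy vertex outside \<open>D\<close> is adjacent to at least two bags
  other than its own, while at most two leaves of a bag are adjacent to another given bag. If \<open>h\<close> counts
  the heavy \<open>d \<in> D\<close> and \<open>l\<close> the other \<open>d \<in> D\<close> whose bag is adjacent to a heavy leaf of a heavy bag, then
  heavy bags contain at most \<open>4 h + 2 l\<close> heavy leaves, and no other selected leaves. A bag of a
  non-heavy \<open>d\<close> lies in \<open>N[d]\<close>, which has at most 7 vertices; if it is adjacent to an
  outside heavy vertex, one vertex of \<open>N[d]\<close> is not selected. The total is at most
  \<open>h + (4 h + 2 l) + 6 l + 7 (|D| - h - l) \<le> 8 |D|\<close>.
\<close>

section \<open>Theta curves\<close>

text \<open>Two arcs that meet exactly in their common ends form a simple closed curve, to which the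
  Jordan curve theorem applies.\<close>

lemma arc_loop_inside_outside:
  fixes c c' :: "real \<Rightarrow> complex"
  assumes "arc c" "arc c'" "pathstart c = a" "pathfinish c = b" "pathstart c' = a" "pathfinish c' = b"
    and "path_image c \<inter> path_image c' = {a, b}"
  defines "L \<equiv> path_image c \<union> path_image c'"
  shows "inside L \<noteq> {}" "connected (inside L)" "connected (outside L)"
    "open (outside L)" "frontier (inside L) = L" "compact L"
proof -
  have sp: "simple_path (c +++ reversepath c')"
    by (rule simple_path_join_loop) (use assms in \<open>auto simp: arc_reversepath\<close>)
  have im: "path_image (c +++ reversepath c') = L"
    using assms by (simp add: path_image_join)
  have "pathfinish (c +++ reversepath c') = pathstart (c +++ reversepath c')"
    using assms by simp
  from Jordan_inside_outside[OF sp this, unfolded im]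
  show "inside L \<noteq> {}" "connected (inside L)" "connected (outside L)"
    "open (outside L)" "frontier (inside L) = L" by simp_all
  show "compact L"
    using assms by (simp add: compact_Un compact_arc_image L_def)
qed

lemma connected_subset_outside:
  assumes "closed L" "connected C" "C \<inter> L = {}" "C \<inter> outside L \<noteq> {}"
  shows "C \<subseteq> outside (L :: 'a::real_normed_vector set)"
proof -
  have "C \<subseteq> inside L \<union> outside L" using assms(3) by auto
  moreover have "open (inside L)" "open (outside L)"
    using assms(1) open_inside open_outside by auto
  moreover have "inside L \<inter> outside L \<inter> C = {}" by simp
  ultimately have "inside L \<inter> C = {} \<or> outside L \<inter> C = {}"
    using assms(2) connectedD by blast
  with \<open>C \<subseteq> inside L \<union> outside L\<close> assms(4) show ?thesis by blast
qed

lemma arc_endless_nonempty: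
  assumes "arc (c :: real \<Rightarrow> 'a::t2_space)" "pathstart c = a" "pathfinish c = b"
  shows "path_image c - {a, b} \<noteq> {}"
proof -
  have "c (1/2) \<in> path_image c" by (simp add: path_image_def)
  moreover have "c (1/2) \<noteq> c 0" "c (1/2) \<noteq> c 1"
    using assms(1) inj_onD[of c "{0..1}" "1/2" 0] inj_onD[of c "{0..1}" "1/2" 1]
    by (auto simp: arc_def)
  ultimately show ?thesis
    using assms by (auto simp: pathstart_def pathfinish_def)
qed

text \<open>If each arc of a theta curve lay outside the loop of the other two, the inside of one loop
  would be separated from infinity by neither of the other two loops, whose intersection is an arc;
  Janiszewski's theorem rules this out.\<close>

lemma theta_curve_arc_not_outside:
  fixes c1 c2 c3 :: "real \<Rightarrow> complex"
  assumes arcs: "arc c1" "arc c2" "arc c3"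
    and ends: "pathstart c1 = a" "pathfinish c1 = b" "pathstart c2 = a" "pathfinish c2 = b"
      "pathstart c3 = a" "pathfinish c3 = b"
    and meet: "path_image c1 \<inter> path_image c2 = {a, b}" "path_image c1 \<inter> path_image c3 = {a, b}"
      "path_image c2 \<inter> path_image c3 = {a, b}"
    and out: "path_image c1 - {a, b} \<subseteq> outside (path_image c2 \<union> path_image c3)"
      "path_image c2 - {a, b} \<subseteq> outside (path_image c1 \<union> path_image c3)"
      "path_image c3 - {a, b} \<subseteq> outside (path_image c1 \<union> path_image c2)"
  shows False
proof -
  define L12 L13 L23 where L: "L12 = path_image c1 \<union> path_image c2"
    "L13 = path_image c1 \<union> path_image c3" "L23 = path_image c2 \<union> path_image c3"
  note l12 = arc_loop_inside_outside[OF arcs(1,2) ends(1-4) meet(1), folded L]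
  note l13 = arc_loop_inside_outside[OF arcs(1,3) ends(1,2,5,6) meet(2), folded L]
  note l23 = arc_loop_inside_outside[OF arcs(2,3) ends(3-6) meet(3), folded L]
  have "inside L13 \<inter> path_image c2 = {}"
  proof -
    have "{a, b} \<subseteq> L13" using meet(2) L by auto
    moreover have "path_image c2 - {a, b} \<subseteq> outside L13" using out(2) L by simp
    ultimately show ?thesis
      using inside_no_overlap[of L13] inside_Int_outside[of L13] by blast
  qed
  then have dis: "inside L13 \<inter> L12 = {}" "inside L13 \<inter> L23 = {}"
    using inside_no_overlap[of L13] unfolding L by blast+
  \<comment> \<open>An inner point of \<open>c3\<close> is a boundary point of
    \<open>inside L13\<close> and lies in the open set \<open>outside L12\<close>, so the two sets
    meet; connectedness then puts all of \<open>inside L13\<close> into \<open>outside L12\<close>.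
    The same works for \<open>L23\<close> with a point of \<open>c1\<close>.\<close>
  have "inside L13 \<inter> outside L12 \<noteq> {}"
  proof -
    obtain q where "q \<in> path_image c3 - {a, b}"
      using arc_endless_nonempty[OF arcs(3) ends(5,6)] by auto
    then have "q \<in> outside L12" "q \<in> frontier (inside L13)"
      using out(3) l13(5) by (auto simp: L)
    then show ?thesis
      using open_Int_closure_eq_empty[OF l12(4), of "inside L13"] by (auto simp: frontier_def)
  qed
  then have s12: "inside L13 \<subseteq> outside L12"
    by (intro connected_subset_outside l13 dis compact_imp_closed l12)
  have "inside L13 \<inter> outside L23 \<noteq> {}"
  proof -
    obtain q where "q \<in> path_image c1 - {a, b}"
      using arc_endless_nonempty[OF arcs(1) ends(1,2)] by auto
    then have "q \<in> outside L23" "q \<in> frontier (inside L13)"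
      using out(1) l13(5) by (auto simp: L)
    then show ?thesis
      using open_Int_closure_eq_empty[OF l23(4), of "inside L13"] by (auto simp: frontier_def)
  qed
  then have s23: "inside L13 \<subseteq> outside L23"
    by (intro connected_subset_outside l13 dis compact_imp_closed l23)
  obtain x where x: "x \<in> inside L13" using l13(1) by auto
  \<comment> \<open>A point \<open>y\<close> far enough away lies outside all three loops.\<close>
  have "bounded (- outside L12 \<union> - outside L23 \<union> - outside L13)"
    using l12(6) l13(6) l23(6) by (simp add: cobounded_outside compact_imp_bounded)
  then have "- outside L12 \<union> - outside L23 \<union> - outside L13 \<noteq> UNIV"
    using not_bounded_UNIV by metis
  then obtain y where y: "y \<in> outside L12" "y \<in> outside L23" "y \<in> outside L13"
    by auto
  have sub: "outside L \<subseteq> - L" for L :: "complex set"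
    using outside_no_overlap[of L] by blast
  have "connected_component (- L12) x y"
    using l12(3) sub x y(1) s12 unfolding connected_component_def by blast
  moreover have "connected_component (- L23) x y"
    using l23(3) sub x y(2) s23 unfolding connected_component_def by blast
  moreover have "L12 \<inter> L23 = path_image c2"
    using meet by (auto simp: L)
  moreover have "connected (path_image c2)"
    using arcs(2) connected_arc_image by blast
  \<comment> \<open>Janiszewski: neither \<open>L12\<close> nor \<open>L23\<close> separates
    \<open>x\<close> from \<open>y\<close> and their intersection is connected, so their union,
    which contains \<open>L13\<close>, does not separate them either.\<close>
  ultimately have "connected_component (- (L12 \<union> L23)) x y"
    using Janiszewski[OF l12(6) compact_imp_closed[OF l23(6)]] by simp
  then have "connected_component (- L13) x y"
    by (rule connected_component_of_subset) (auto simp: L)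
  then have "x \<in> outside L13"
    using y(3) outside_same_component[of L13 y x] connected_component_sym[of "- L13" x y] by blast
  with x show False using inside_Int_outside by blast
qed

text \<open>\<open>U\<close> is meant to be the outer face and \<open>v\<close> a point on its
  boundary. The component of \<open>- L\<close> around \<open>U\<close> is unbounded, and the inside
  of \<open>L\<close> is open, so it would meet \<open>U\<close> if it contained
  \<open>v\<close>.\<close>

lemma closure_unbounded_connected_in_outside:
  assumes "closed L" "connected U" "\<not> bounded U" "U \<inter> L = {}" "v \<in> closure U" "v \<notin> L"
  shows "v \<in> outside (L :: 'a::real_normed_vector set)"
proof -
  have "U \<subseteq> outside L"
  proof
    fix u assume u: "u \<in> U"
    have "U \<subseteq> connected_component_set (- L) u"
      using assms u by (intro connected_component_maximal) auto
    then have "\<not> bounded (connected_component_set (- L) u)"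
      using assms(3) bounded_subset by blast
    with u assms(4) show "u \<in> outside L" by (auto simp: outside_def)
  qed
  moreover have "v \<notin> inside L"
  proof
    assume "v \<in> inside L"
    moreover have "open (inside L)" using assms(1) open_inside by blast
    ultimately have "inside L \<inter> U \<noteq> {}"
      using assms(5) open_Int_closure_eq_empty by blast
    with \<open>U \<subseteq> outside L\<close> inside_Int_outside show False by blast
  qed
  ultimately show ?thesis using assms(6) inside_Un_outside[of L] by blast
qed

text \<open>The sets \<open>T i\<close> are thickened arcs: replacing each of them by an arc inside it yields a
  theta curve.\<close>

lemma thick_theta_not_touched_by_face:
  fixes T :: "nat \<Rightarrow> complex set"
  assumes "a \<noteq> b"
    and T: "\<And>i. i < 3 \<Longrightarrow> path_connected (T i)" "\<And>i. i < 3 \<Longrightarrow> a \<in> T i" "\<And>i. i < 3 \<Longrightarrow> b \<in> T i"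
      "\<And>i. i < 3 \<Longrightarrow> connected (T i - {a, b})"
      "\<And>i j. i < 3 \<Longrightarrow> j < 3 \<Longrightarrow> i \<noteq> j \<Longrightarrow> T i \<inter> T j \<subseteq> {a, b}"
    and U: "connected U" "\<not> bounded U" "\<And>i. i < 3 \<Longrightarrow> U \<inter> T i = {}"
      "\<And>i. i < 3 \<Longrightarrow> closure U \<inter> (T i - {a, b}) \<noteq> {}"
  shows False
proof -
  have "\<exists>g. arc g \<and> path_image g \<subseteq> T i \<and> pathstart g = a \<and> pathfinish g = b" if "i < 3" for i
    using T(1-3)[OF that] \<open>a \<noteq> b\<close> unfolding path_connected_arcwise by blast
  then obtain c where c: "\<And>i. i < 3 \<Longrightarrow> arc (c i)" "\<And>i. i < 3 \<Longrightarrow> path_image (c i) \<subseteq> T i"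
    "\<And>i. i < 3 \<Longrightarrow> pathstart (c i) = a" "\<And>i. i < 3 \<Longrightarrow> pathfinish (c i) = b"
    by metis
  have ends: "a \<in> path_image (c i)" "b \<in> path_image (c i)" if "i < 3" for i
    using c(3,4)[OF that] pathstart_in_path_image pathfinish_in_path_image by metis+
  have meet: "path_image (c i) \<inter> path_image (c j) = {a, b}" if "i < 3" "j < 3" "i \<noteq> j" for i j
    using c(2)[OF that(1)] c(2)[OF that(2)] ends that T(5)[OF that] by blast
  have out: "path_image (c k) - {a, b} \<subseteq> outside (path_image (c i) \<union> path_image (c j))"
    if "i < 3" "j < 3" "k < 3" "k \<noteq> i" "k \<noteq> j" for i j k
  proof -
    let ?L = "path_image (c i) \<union> path_image (c j)"
    note ijk = that
    have cl: "closed ?L" using c(1) that by (simp add: closed_Un closed_arc_image)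
    have disj: "(T k - {a, b}) \<inter> ?L = {}"
      using c(2)[OF that(1)] c(2)[OF that(2)] T(5)[OF that(3,1,4)] T(5)[OF that(3,2,5)] by blast
    obtain v where v: "v \<in> closure U" "v \<in> T k - {a, b}"
      using U(4)[OF ijk(3)] by blast
    have "U \<inter> ?L = {}" using c(2)[OF that(1)] c(2)[OF that(2)] U(3) that by blast
    with v disj have "v \<in> outside ?L"
      by (intro closure_unbounded_connected_in_outside[OF cl U(1,2)]) auto
    \<comment> \<open>One point touched by the face suffices: connectedness carries the whole of
      \<open>T k\<close> without its ends to the outside.\<close>
    then have "T k - {a, b} \<subseteq> outside ?L"
      using v by (intro connected_subset_outside cl T that disj) auto
    then show ?thesis using c(2) that by blast
  qed
  show False
    by (rule theta_curve_arc_not_outside[of "c 0" "c 1" "c 2" a b])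
      (use c meet out in simp_all)
qed

section \<open>K23 minors\<close>

text \<open>Connectedness in terms of cuts instead of paths, which suits adding a vertex and pulling
  back along a quotient. The empty set is excluded because branch sets of a minor are
  nonempty.\<close>

definition gconn :: "('a \<Rightarrow> 'a \<Rightarrow> bool) \<Rightarrow> 'a set \<Rightarrow> bool" where
  "gconn E S \<longleftrightarrow> S \<noteq> {} \<and> (\<forall>X. X \<subseteq> S \<longrightarrow> X \<noteq> {} \<longrightarrow> X \<noteq> S \<longrightarrow> (\<exists>x\<in>X. \<exists>y\<in>S - X. E x y))"

definition gadj :: "('a \<Rightarrow> 'a \<Rightarrow> bool) \<Rightarrow> 'a set \<Rightarrow> 'a set \<Rightarrow> bool" where
  "gadj E A B \<longleftrightarrow> (\<exists>x\<in>A. \<exists>y\<in>B. E x y)"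

text \<open>Branch sets of a K23 minor: \<open>A\<close> and \<open>A'\<close> are the two hubs,
  \<open>B 0\<close>, \<open>B 1\<close>, \<open>B 2\<close> the vertices of the other side.\<close>

definition K23_model :: "'a set \<Rightarrow> ('a \<Rightarrow> 'a \<Rightarrow> bool) \<Rightarrow> 'a set \<Rightarrow> 'a set \<Rightarrow> (nat \<Rightarrow> 'a set) \<Rightarrow> bool" where
  "K23_model V E A A' B \<longleftrightarrow>
     A \<subseteq> V \<and> A' \<subseteq> V \<and> gconn E A \<and> gconn E A' \<and> A \<inter> A' = {} \<and>
     (\<forall>i<3. B i \<subseteq> V \<and> gconn E (B i) \<and> B i \<inter> A = {} \<and> B i \<inter> A' = {} \<and>
        gadj E A (B i) \<and> gadj E A' (B i)) \<and>
     (\<forall>i<3. \<forall>j<3. i \<noteq> j \<longrightarrow> B i \<inter> B j = {})"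

definition K23_minor_free :: "'a set \<Rightarrow> ('a \<Rightarrow> 'a \<Rightarrow> bool) \<Rightarrow> bool" where
  "K23_minor_free V E \<longleftrightarrow> (\<nexists>A A' B. K23_model V E A A' B)"

lemma gconn_singleton [simp]: "gconn E {x}"
  by (auto simp: gconn_def)

lemma gconnD:
  "gconn E S \<Longrightarrow> X \<subseteq> S \<Longrightarrow> X \<noteq> {} \<Longrightarrow> X \<noteq> S \<Longrightarrow> \<exists>x\<in>X. \<exists>y\<in>S - X. E x y"
  by (simp add: gconn_def)

lemma gconn_insert:
  assumes S: "gconn E S" and "y \<in> S" "E x y" "symp E"
  shows "gconn E (insert x S)"
proof (cases "x \<in> S")
  case True
  then show ?thesis using S by (simp add: insert_absorb)
next
  case x: False
  show ?thesis unfolding gconn_def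
  proof (intro conjI allI impI)
    fix X assume X: "X \<subseteq> insert x S" "X \<noteq> {}" "X \<noteq> insert x S"
    show "\<exists>a\<in>X. \<exists>b\<in>insert x S - X. E a b"
    proof (cases "X \<inter> S = {} \<or> S \<subseteq> X")
      case True
      then consider "X = {x}" | "X = S" using X by blast
      then show ?thesis
        using assms x by cases (auto dest: sympD)
    next
      case False
      then have "\<exists>a\<in>X \<inter> S. \<exists>b\<in>S - X \<inter> S. E a b"
        using gconnD[OF S, of "X \<inter> S"] by blast
      then show ?thesis by blast
    qed
  qed simp
qed

text \<open>A maximal proper connected subset containing \<open>r\<close> misses exactly one vertex,
  since any vertex adjacent to it can be added. The prescribed \<open>r\<close> allows a second,
  different removable vertex to be found.\<close>

lemma gconn_remove_vertex:
  assumes A: "gconn E A" "finite A" "r \<in> A" "A \<noteq> {r}" and "symp E"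
  shows "\<exists>x\<in>A - {r}. gconn E (A - {x})"
proof -
  let ?F = "{M. M \<subseteq> A \<and> M \<noteq> A \<and> r \<in> M \<and> gconn E M}"
  have "finite ?F" "{r} \<in> ?F" using A by auto
  then obtain M where M: "M \<in> ?F" and max: "\<forall>N\<in>?F. M \<subseteq> N \<longrightarrow> M = N"
    using finite_has_maximal[of ?F] by (metis (no_types, lifting) empty_iff)
  have "\<exists>x\<in>M. \<exists>y\<in>A - M. E x y" using gconnD[OF A(1), of M] M(1) by blast
  then obtain y z where y: "y \<in> A - M" "z \<in> M" "E y z"
    using \<open>symp E\<close> by (blast dest: sympD)
  then have "gconn E (insert y M)" using M(1) \<open>symp E\<close> gconn_insert by fast
  then have "insert y M = A"
    using M y max[rule_format, of "insert y M"] by auto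
  then have "A - {y} = M" using y by blast
  then show ?thesis using M(1) y by blast
qed

lemma K23_modelD:
  assumes "K23_model V E A A' B"
  shows "A \<subseteq> V" "A' \<subseteq> V" "gconn E A" "gconn E A'" "A \<inter> A' = {}"
    "\<And>i. i < 3 \<Longrightarrow> B i \<subseteq> V" "\<And>i. i < 3 \<Longrightarrow> gconn E (B i)"
    "\<And>i. i < 3 \<Longrightarrow> B i \<inter> A = {}" "\<And>i. i < 3 \<Longrightarrow> B i \<inter> A' = {}"
    "\<And>i. i < 3 \<Longrightarrow> gadj E A (B i)" "\<And>i. i < 3 \<Longrightarrow> gadj E A' (B i)"
    "\<And>i j. i < 3 \<Longrightarrow> j < 3 \<Longrightarrow> i \<noteq> j \<Longrightarrow> B i \<inter> B j = {}"
  using assms unfolding K23_model_def by blast+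

lemma K23_model_swap: "K23_model V E A A' B \<Longrightarrow> K23_model V E A' A B"
  unfolding K23_model_def by blast

text \<open>Pigeonhole: two disjoint predicates cannot both hold at two of three indices. The index
  \<open>k\<close> is the only possible place of the rarer one.\<close>

lemma disjoint_predicates_on_3:
  assumes "\<And>i::nat. i < 3 \<Longrightarrow> \<not> (P i \<and> Q i)"
  shows "(\<exists>k<3. \<forall>i<3. i \<noteq> k \<longrightarrow> \<not> P i) \<or> (\<exists>k<3. \<forall>i<3. i \<noteq> k \<longrightarrow> \<not> Q i)"
proof -
  have "i < 3 \<longleftrightarrow> i = 0 \<or> i = 1 \<or> i = 2" for i :: nat by auto
  then show ?thesis using assms[of 0] assms[of 1] assms[of 2] by auto
qed

text \<open>Two different non-cut vertices of \<open>A\<close> cannot both be the only neighbour in \<open>A\<close> of two of the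
  three sets \<open>B i\<close>, so one of them can be dropped or moved into some \<open>B i\<close>.\<close>

lemma K23_model_shrink_step:
  assumes K: "K23_model V E A A' B" and "finite A" "symp E" and A2: "\<nexists>x. A = {x}"
  shows "\<exists>x\<in>A. \<exists>B'. K23_model V E (A - {x}) A' B'"
proof -
  note K' = K23_modelD[OF K]
  obtain r where r: "r \<in> A" using K'(3) by (auto simp: gconn_def)
  obtain x where x: "x \<in> A" "gconn E (A - {x})"
    using gconn_remove_vertex[OF K'(3) \<open>finite A\<close> r _ \<open>symp E\<close>] A2 by blast
  \<comment> \<open>Protecting \<open>x\<close> makes the second non-cut vertex different from the
    first.\<close>
  obtain y where y: "y \<in> A" "y \<noteq> x" "gconn E (A - {y})"
    using gconn_remove_vertex[OF K'(3) \<open>finite A\<close> x(1) _ \<open>symp E\<close>] A2 by blast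
  let ?only = "\<lambda>z i. \<not> gadj E (A - {z}) (B i)"
  have step: "\<exists>B'. K23_model V E (A - {z}) A' B'"
    if z: "z \<in> A" "gconn E (A - {z})" and k: "k < 3" "\<And>i. i < 3 \<Longrightarrow> i \<noteq> k \<Longrightarrow> \<not> ?only z i" for z k
  proof (cases "?only z k")
    case False
    then have "\<And>i. i < 3 \<Longrightarrow> gadj E (A - {z}) (B i)" using k by blast
    then have "K23_model V E (A - {z}) A' B"
      using K z unfolding K23_model_def by blast
    then show ?thesis by blast
  next
    case True
    obtain b where b: "b \<in> B k" "E z b"
      using True K'(10)[OF k(1)] unfolding gadj_def by blast
    have "A - {z} \<noteq> {}" using z(2) by (simp add: gconn_def)
    then obtain w where w: "w \<in> A - {z}" "E z w"
      using gconnD[OF K'(3), of "{z}"] z(1) by blast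
    \<comment> \<open>\<open>z\<close> is the only contact of \<open>A\<close> with
      \<open>B k\<close>. After it moves into \<open>B k\<close>, the edge from \<open>z\<close> to
      \<open>w\<close> provides the contact with \<open>A - {z}\<close>.\<close>
    let ?B = "B(k := insert z (B k))"
    have "K23_model V E (A - {z}) A' ?B"
      unfolding K23_model_def
    proof (intro conjI allI impI)
      fix i :: nat assume i: "i < 3"
      show "?B i \<subseteq> V" using K'(1,6) i z by auto
      show "gconn E (?B i)"
        using gconn_insert[OF K'(7)[OF k(1)] b(1) b(2) \<open>symp E\<close>] K'(7) i by auto
      show "?B i \<inter> (A - {z}) = {}" using K'(8)[OF i] by auto
      show "?B i \<inter> A' = {}" using K'(5) K'(9)[OF i] z by auto
      show "gadj E (A - {z}) (?B i)"
        using k(2) i w \<open>symp E\<close> unfolding gadj_def by (auto dest: sympD)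
      show "gadj E A' (?B i)" using K'(11)[OF i] unfolding gadj_def by auto
      fix j :: nat assume "j < 3" "i \<noteq> j"
      then show "?B i \<inter> ?B j = {}"
        using K'(12)[of i j] i K'(8)[of i] K'(8)[of j] z by auto
    qed (use K' z in auto)
    then show ?thesis by blast
  qed
  \<comment> \<open>A contact of \<open>A\<close> with \<open>B i\<close> differs from
    \<open>x\<close> or from \<open>y\<close> and survives the removal of that vertex.\<close>
  have excl: "\<not> (?only x i \<and> ?only y i)" if "i < 3" for i
    using K'(10)[OF that] y(2) unfolding gadj_def by blast
  have "(\<exists>k<3. \<forall>i<3. i \<noteq> k \<longrightarrow> \<not> ?only x i) \<or> (\<exists>k<3. \<forall>i<3. i \<noteq> k \<longrightarrow> \<not> ?only y i)"
    by (rule disjoint_predicates_on_3) (use excl in blast)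
  then show ?thesis
  proof (elim disjE exE conjE)
    fix k :: nat assume k: "k < 3" "\<forall>i<3. i \<noteq> k \<longrightarrow> \<not> ?only x i"
    have "\<exists>B'. K23_model V E (A - {x}) A' B'"
      by (rule step[OF x k(1)]) (use k(2) in blast)
    then show ?thesis using x(1) by (rule bexI)
  next
    fix k :: nat assume k: "k < 3" "\<forall>i<3. i \<noteq> k \<longrightarrow> \<not> ?only y i"
    have "\<exists>B'. K23_model V E (A - {y}) A' B'"
      by (rule step[OF y(1,3) k(1)]) (use k(2) in blast)
    then show ?thesis using y(1) by (rule bexI)
  qed
qed

lemma K23_model_shrink:
  assumes "K23_model V E A A' B" "finite A" "symp E"
  shows "\<exists>x\<in>A. \<exists>B'. K23_model V E {x} A' B'"
  using assms
proof (induction "card A" arbitrary: A B rule: less_induct)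
  case less
  show ?case
  proof (cases "\<exists>x. A = {x}")
    case True
    then show ?thesis using less.prems by blast
  next
    case False
    then obtain x B' where x: "x \<in> A" "K23_model V E (A - {x}) A' B'"
      using K23_model_shrink_step less.prems by metis
    moreover have "card (A - {x}) < card A"
      using x(1) less.prems(2) by (meson card_Diff1_less)
    ultimately show ?thesis
      using less.hyps[of "A - {x}" B'] less.prems by blast
  qed
qed

text \<open>Shrinking one hub leaves the other unchanged, so a swap handles both. Single vertices
  are wanted as hubs because they become the two branch points of a theta curve.\<close>

lemma not_K23_minor_freeE:
  assumes "\<not> K23_minor_free V E" "finite V" "symp E"
  obtains x y B where "K23_model V E {x} {y} B"
proof -
  obtain A A' B where K: "K23_model V E A A' B"
    using assms(1) unfolding K23_minor_free_def by blast
  have "finite A" "finite A'"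
    using K assms(2) K23_modelD(1,2) finite_subset by metis+
  obtain x B1 where "K23_model V E {x} A' B1"
    using K23_model_shrink[OF K \<open>finite A\<close> assms(3)] by blast
  then obtain y B2 where "K23_model V E {y} {x} B2"
    using K23_model_shrink[OF K23_model_swap \<open>finite A'\<close> assms(3)] by blast
  then show ?thesis using that by blast
qed

section \<open>Quotients by connected fibres\<close>

definition quotient_adj :: "'a set \<Rightarrow> ('a \<Rightarrow> 'a \<Rightarrow> bool) \<Rightarrow> ('a \<Rightarrow> 'b) \<Rightarrow> 'b \<Rightarrow> 'b \<Rightarrow> bool" where
  "quotient_adj V E f x y \<longleftrightarrow> x \<noteq> y \<and> (\<exists>u\<in>V. \<exists>v\<in>V. f u = x \<and> f v = y \<and> E u v)"

lemma symp_quotient_adj: "symp E \<Longrightarrow> symp (quotient_adj V E f)"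
  unfolding symp_def quotient_adj_def by blast

text \<open>A cut of the preimage either splits a fibre, which is connected, or is a union of fibres
  and comes from a cut of \<open>S\<close>.\<close>

lemma gconn_quotient_vimage:
  assumes fib: "\<And>x. x \<in> f ` V \<Longrightarrow> gconn E {v \<in> V. f v = x}"
    and S: "gconn (quotient_adj V E f) S" "S \<subseteq> f ` V"
  shows "gconn E {v \<in> V. f v \<in> S}" (is "gconn E ?P")
  unfolding gconn_def
proof (intro conjI allI impI)
  show "?P \<noteq> {}" using S by (auto simp: gconn_def)
  fix X assume X: "X \<subseteq> ?P" "X \<noteq> {}" "X \<noteq> ?P"
  show "\<exists>x\<in>X. \<exists>y\<in>?P - X. E x y"
  proof (cases "\<exists>u\<in>X. \<exists>v\<in>?P - X. f u = f v")
    case True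
    then obtain u v where uv: "u \<in> X" "v \<in> ?P - X" "f u = f v" by blast
    let ?F = "{w \<in> V. f w = f u}"
    have "gconn E ?F" using fib uv X by blast
    moreover have "X \<inter> ?F \<noteq> {}" "X \<inter> ?F \<noteq> ?F" using uv X by auto
    ultimately have "\<exists>x\<in>X \<inter> ?F. \<exists>y\<in>?F - X \<inter> ?F. E x y"
      by (intro gconnD) auto
    then show ?thesis using uv X by auto
  next
    case False
    have "f ` X \<subseteq> S" "f ` X \<noteq> {}" using X by auto
    moreover have "f ` X \<noteq> S"
    proof
      assume eq: "f ` X = S"
      obtain v where v: "v \<in> ?P - X" using X by auto
      then have "f v \<in> f ` X" using eq by simp
      then obtain u where "u \<in> X" "f u = f v" by force
      then show False using v False by metis
    qed
    ultimately have "\<exists>x\<in>f ` X. \<exists>y\<in>S - f ` X. quotient_adj V E f x y"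
      by (intro gconnD[OF S(1)])
    then obtain u v where "u \<in> V" "v \<in> V" "f u \<in> f ` X" "f v \<in> S - f ` X" "E u v"
      unfolding quotient_adj_def by blast
    moreover from this have "f u \<in> S" using X by auto
    moreover have "u \<in> X"
    proof (rule ccontr)
      assume "u \<notin> X"
      moreover obtain x where "x \<in> X" "f x = f u" using \<open>f u \<in> f ` X\<close> by force
      ultimately show False using False \<open>u \<in> V\<close> \<open>f u \<in> S\<close> by blast
    qed
    moreover have "v \<notin> X" using calculation by auto
    ultimately show ?thesis by auto
  qed
qed

text \<open>A minor of a minor is a minor: the preimages of branch sets are branch sets.\<close>

lemma K23_minor_free_quotient:
  assumes free: "K23_minor_free V E"
    and fib: "\<And>x. x \<in> f ` V \<Longrightarrow> gconn E {v \<in> V. f v = x}"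
  shows "K23_minor_free (f ` V) (quotient_adj V E f)"
  unfolding K23_minor_free_def
proof (intro notI; elim exE)
  let ?P = "\<lambda>S. {v \<in> V. f v \<in> S}"
  fix A A' B assume K: "K23_model (f ` V) (quotient_adj V E f) A A' B"
  note K' = K23_modelD[OF K]
  have adj: "gadj E (?P S) (?P T)" if "gadj (quotient_adj V E f) S T" for S T
    using that unfolding gadj_def quotient_adj_def by blast
  have "K23_model V E (?P A) (?P A') (\<lambda>i. ?P (B i))"
    unfolding K23_model_def
  proof (intro conjI allI impI)
    show "gconn E (?P A)" "gconn E (?P A')"
      using gconn_quotient_vimage[OF fib] K'(1-4) by auto
    show "?P A \<inter> ?P A' = {}" using K'(5) by auto
    fix i :: nat assume i: "i < 3"
    show "gconn E (?P (B i))" using gconn_quotient_vimage[OF fib] K'(6,7) i by auto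
    show "?P (B i) \<inter> ?P A = {}" using K'(8)[OF i] by auto
    show "?P (B i) \<inter> ?P A' = {}" using K'(9)[OF i] by auto
    show "gadj E (?P A) (?P (B i))" "gadj E (?P A') (?P (B i))"
      using K'(10,11)[OF i] by (auto intro: adj)
    fix j :: nat assume "j < 3" "i \<noteq> j"
    then show "?P (B i) \<inter> ?P (B j) = {}" using K'(12)[OF i, of j] by auto
  qed auto
  then show False using free unfolding K23_minor_free_def by blast
qed

lemma K23_minor_free_subset: "W \<subseteq> V \<Longrightarrow> K23_minor_free V E \<Longrightarrow> K23_minor_free W E"
  unfolding K23_minor_free_def
proof (elim contrapos_nn exE)
  fix A A' B assume "K23_model W E A A' B" "W \<subseteq> V"
  then have "K23_model V E A A' B"
    unfolding K23_model_def by (meson order_trans)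
  then show "\<exists>A A' B. K23_model V E A A' B" by blast
qed

section \<open>Edge density\<close>

lemma K23_minor_freeD:
  assumes "K23_minor_free V E"
    and "A \<subseteq> V" "A' \<subseteq> V" "B0 \<subseteq> V" "B1 \<subseteq> V" "B2 \<subseteq> V"
    and "gconn E A" "gconn E A'" "gconn E B0" "gconn E B1" "gconn E B2"
    and "A \<inter> A' = {}" "B0 \<inter> A = {}" "B1 \<inter> A = {}" "B2 \<inter> A = {}"
      "B0 \<inter> A' = {}" "B1 \<inter> A' = {}" "B2 \<inter> A' = {}"
      "B0 \<inter> B1 = {}" "B0 \<inter> B2 = {}" "B1 \<inter> B2 = {}"
    and "gadj E A B0" "gadj E A B1" "gadj E A B2" "gadj E A' B0" "gadj E A' B1" "gadj E A' B2"
  shows False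
proof -
  have "K23_model V E A A' (\<lambda>i. if i = 0 then B0 else if i = 1 then B1 else B2)"
    unfolding K23_model_def using assms(2-) by (simp add: Int_commute)
  then show False using assms(1) unfolding K23_minor_free_def by blast
qed

lemma card_ge_3E:
  assumes "\<not> card S \<le> 2"
  obtains a b c where "a \<in> S" "b \<in> S" "c \<in> S" "a \<noteq> b" "a \<noteq> c" "b \<noteq> c"
proof -
  have "3 \<le> card S" using assms by simp
  then obtain T where "T \<subseteq> S" "card T = 3" by (metis obtain_subset_with_card_n)
  then show ?thesis using that by (auto simp: card_3_iff)
qed

text \<open>Three common neighbours would give K23 as a subgraph.\<close>

lemma card_common_neighbours_le_2:
  assumes "K23_minor_free V E" "symp E" "irreflp E" "u \<in> V" "v \<in> V" "u \<noteq> v"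
  shows "card {w \<in> V. E u w \<and> E v w} \<le> 2"
proof (rule ccontr)
  assume "\<not> ?thesis"
  then obtain a b c where w: "a \<in> V" "b \<in> V" "c \<in> V" "a \<noteq> b" "a \<noteq> c" "b \<noteq> c"
    "E u a" "E v a" "E u b" "E v b" "E u c" "E v c"
    by (elim card_ge_3E) blast
  have "E x y \<Longrightarrow> x \<noteq> y" for x y using assms(3) by (auto simp: irreflp_def)
  then show False
    using w assms by (intro K23_minor_freeD[OF assms(1), of "{u}" "{v}" "{a}" "{b}" "{c}"])
      (auto simp: gadj_def)
qed

text \<open>Edges are counted as ordered pairs, so every cardinality below is twice a number of
  edges.\<close>

definition adj_pairs :: "'a set \<Rightarrow> ('a \<Rightarrow> 'a \<Rightarrow> bool) \<Rightarrow> ('a \<times> 'a) set" where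
  "adj_pairs V E = {(x, y). x \<in> V \<and> y \<in> V \<and> E x y}"

lemma finite_adj_pairs [simp]: "finite V \<Longrightarrow> finite (adj_pairs V E)"
  by (rule finite_subset[of _ "V \<times> V"]) (auto simp: adj_pairs_def)

lemma even_card_adj_pairs:
  assumes "finite V" "symp E" "irreflp E"
  shows "even (card (adj_pairs V E))"
  using assms(1)
proof (induction V rule: finite_induct)
  case empty
  then show ?case by (simp add: adj_pairs_def)
next
  case (insert z V)
  let ?N = "{y \<in> V. E z y}"
  have "adj_pairs (insert z V) E = adj_pairs V E \<union> (Pair z ` ?N \<union> (\<lambda>y. (y, z)) ` ?N)"
    using assms by (auto simp: adj_pairs_def symp_def irreflp_def)
  moreover have "adj_pairs V E \<inter> (Pair z ` ?N \<union> (\<lambda>y. (y, z)) ` ?N) = {}"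
    using insert by (auto simp: adj_pairs_def)
  moreover have "Pair z ` ?N \<inter> (\<lambda>y. (y, z)) ` ?N = {}"
    using insert by auto
  moreover have "card (Pair z ` ?N) = card ?N" "card ((\<lambda>y. (y, z)) ` ?N) = card ?N"
    by (auto intro!: card_image inj_onI)
  ultimately have "card (adj_pairs (insert z V) E) = card (adj_pairs V E) + 2 * card ?N"
    using insert by (simp add: card_Un_disjoint)
  then show ?case using insert by simp
qed

section \<open>Edges lost by a contraction\<close>

definition contract :: "'a set \<Rightarrow> 'a \<Rightarrow> 'a \<Rightarrow> 'a" where
  "contract K k x = (if x \<in> K then k else x)"

lemma contract_image: "k \<in> K \<Longrightarrow> K \<subseteq> V \<Longrightarrow> contract K k ` V = insert k (V - K)"
  by (auto simp: contract_def image_def)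

lemma K23_minor_free_contract:
  assumes "K23_minor_free V E" "k \<in> K" "K \<subseteq> V" "gconn E K"
  shows "K23_minor_free (contract K k ` V) (quotient_adj V E (contract K k))"
proof (rule K23_minor_free_quotient[OF assms(1)])
  fix x assume "x \<in> contract K k ` V"
  then have "x = k \<or> x \<in> V - K" using contract_image[OF assms(2,3)] by auto
  then have "{v \<in> V. contract K k v = x} = K \<or> {v \<in> V. contract K k v = x} = {x}"
    using assms(2,3) by (auto simp: contract_def)
  then show "gconn E {v \<in> V. contract K k v = x}" using assms(4) by auto
qed

text \<open>\<open>L\<close> collects the lost pairs: those that become loops, and enough of those
  that become parallel to make the rest embed into the quotient.\<close>

lemma card_adj_pairs_contract:
  assumes "finite V" "finite L"
    and inj: "inj_on (map_prod (contract K k) (contract K k)) (adj_pairs V E - L)"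
    and L: "\<And>x y. (x, y) \<in> adj_pairs V E - L \<Longrightarrow> contract K k x \<noteq> contract K k y"
  shows "card (adj_pairs V E)
    \<le> card (adj_pairs (contract K k ` V) (quotient_adj V E (contract K k))) + card L"
proof -
  have "card (adj_pairs V E - L)
      \<le> card (adj_pairs (contract K k ` V) (quotient_adj V E (contract K k)))"
  proof (rule card_inj_on_le[OF inj])
    show "map_prod (contract K k) (contract K k) ` (adj_pairs V E - L)
        \<subseteq> adj_pairs (contract K k ` V) (quotient_adj V E (contract K k))"
    proof
      fix q assume "q \<in> map_prod (contract K k) (contract K k) ` (adj_pairs V E - L)"
      then obtain x y where xy: "(x, y) \<in> adj_pairs V E - L"
        "q = (contract K k x, contract K k y)" by auto
      then show "q \<in> adj_pairs (contract K k ` V) (quotient_adj V E (contract K k))"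
        using L[OF xy(1)] unfolding adj_pairs_def quotient_adj_def by auto
    qed
  qed (use assms(1) in simp)
  moreover have "card (adj_pairs V E) \<le> card (adj_pairs V E - L) + card L"
    using diff_card_le_card_Diff[OF assms(2), of "adj_pairs V E"] by linarith
  ultimately show ?thesis by linarith
qed

lemma card_adj_pairs_contract_edge:
  assumes "finite V" "symp E" "irreflp E" "u \<in> V" "v \<in> V" "E u v"
  shows "card (adj_pairs V E)
    \<le> card (adj_pairs (contract {u, v} u ` V) (quotient_adj V E (contract {u, v} u)))
      + 2 + 2 * card {w \<in> V. E u w \<and> E v w}"
proof -
  let ?C = "{w \<in> V. E u w \<and> E v w}"
  \<comment> \<open>The contracted edge disappears, and for each common neighbour \<open>w\<close>
    the edges to \<open>u\<close> and \<open>v\<close> merge; the one at \<open>v\<close> is given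
    up, in both directions.\<close>
  let ?L = "{(u, v), (v, u)} \<union> (Pair v ` ?C \<union> (\<lambda>w. (w, v)) ` ?C)"
  have "u \<noteq> v" using assms by (auto simp: irreflp_def)
  have "card ?L \<le> card {(u, v), (v, u)} + (card (Pair v ` ?C) + card ((\<lambda>w. (w, v)) ` ?C))"
    by (intro order_trans[OF card_Un_le] add_left_mono card_Un_le)
  also have "\<dots> \<le> 2 + (card ?C + card ?C)"
    using assms(1) \<open>u \<noteq> v\<close> by (intro add_mono card_image_le) auto
  finally have "card ?L \<le> 2 + 2 * card ?C" by simp
  moreover have "card (adj_pairs V E)
    \<le> card (adj_pairs (contract {u, v} u ` V) (quotient_adj V E (contract {u, v} u))) + card ?L"
  proof (rule card_adj_pairs_contract)
    have E: "E x y \<Longrightarrow> E y x" "\<not> E x x" for x y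
      using assms by (auto simp: symp_def irreflp_def)
    show "contract {u, v} u x \<noteq> contract {u, v} u y" if "(x, y) \<in> adj_pairs V E - ?L" for x y
      using that E by (auto simp: contract_def adj_pairs_def split: if_splits)
    show "inj_on (map_prod (contract {u, v} u) (contract {u, v} u)) (adj_pairs V E - ?L)"
    proof (rule inj_onI)
      fix q q' assume q: "q \<in> adj_pairs V E - ?L" "q' \<in> adj_pairs V E - ?L"
        "map_prod (contract {u, v} u) (contract {u, v} u) q
          = map_prod (contract {u, v} u) (contract {u, v} u) q'"
      obtain x y x' y' where qq: "q = (x, y)" "q' = (x', y')" by (cases q, cases q')
      have p: "(x, y) \<in> adj_pairs V E" "(x, y) \<notin> ?L" "(x', y') \<in> adj_pairs V E" "(x', y') \<notin> ?L"
        using q qq by blast+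
      from q(3) qq have eq: "x = x' \<or> x \<in> {u, v} \<and> x' \<in> {u, v}" "y = y' \<or> y \<in> {u, v} \<and> y' \<in> {u, v}"
        by (auto simp: contract_def split: if_splits)
      have ab: "a \<in> V" "b \<in> V" "E a b" "E b a" "a \<noteq> b" "\<not> (a \<in> {u, v} \<and> b \<in> {u, v})"
        "a = v \<Longrightarrow> \<not> E u b" "b = v \<Longrightarrow> \<not> E u a"
        if "(a, b) \<in> adj_pairs V E" "(a, b) \<notin> ?L" for a b
        using that E by (auto simp: adj_pairs_def)
      note 1 = ab[OF p(1,2)] and 2 = ab[OF p(3,4)]
      have "x = x' \<and> y = y'"
        using eq 1 2 E \<open>u \<noteq> v\<close> by blast
      then show "q = q'" using qq by simp
    qed
  qed (use assms in auto)
  ultimately show ?thesis by linarith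
qed

text \<open>By \<open>sep\<close> no two edges leaving \<open>K\<close> become parallel, so only the
  pairs inside \<open>K\<close> are lost.\<close>

lemma card_adj_pairs_contract_separated:
  assumes "finite V" "symp E" "irreflp E" "K \<subseteq> V" "k \<in> K"
    and sep: "\<And>x y w. x \<in> K \<Longrightarrow> y \<in> K \<Longrightarrow> w \<in> V - K \<Longrightarrow> E x w \<Longrightarrow> E y w \<Longrightarrow> x = y"
  shows "card (adj_pairs V E) \<le> card (adj_pairs (contract K k ` V) (quotient_adj V E (contract K k)))
    + card (adj_pairs K E)"
proof (rule card_adj_pairs_contract)
  have fK: "finite K" using assms finite_subset by blast
  then show "finite (adj_pairs K E)" by simp
  have E: "E x y \<Longrightarrow> E y x" "\<not> E x x" for x y
    using assms by (auto simp: symp_def irreflp_def)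
  show "contract K k x \<noteq> contract K k y" if "(x, y) \<in> adj_pairs V E - adj_pairs K E" for x y
    using that E \<open>k \<in> K\<close> by (auto simp: contract_def adj_pairs_def split: if_splits)
  show "inj_on (map_prod (contract K k) (contract K k)) (adj_pairs V E - adj_pairs K E)"
  proof (rule inj_onI, clarify)
    fix x y x' y'
    assume p: "(x, y) \<in> adj_pairs V E" "(x, y) \<notin> adj_pairs K E"
      "(x', y') \<in> adj_pairs V E" "(x', y') \<notin> adj_pairs K E"
      and "map_prod (contract K k) (contract K k) (x, y) = map_prod (contract K k) (contract K k) (x', y')"
    then have eq: "x = x' \<or> x \<in> K \<and> x' \<in> K" "y = y' \<or> y \<in> K \<and> y' \<in> K"
      using \<open>k \<in> K\<close> by (auto simp: contract_def split: if_splits)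
    have ab: "a \<in> V" "b \<in> V" "E a b" "E b a" "\<not> (a \<in> K \<and> b \<in> K)"
      if "(a, b) \<in> adj_pairs V E" "(a, b) \<notin> adj_pairs K E" for a b
      using that E by (auto simp: adj_pairs_def)
    note 1 = ab[OF p(1,2)] and 2 = ab[OF p(3,4)]
    show "x = x' \<and> y = y'"
      using eq 1 2 sep[of x x' y] sep[of y y' x] by blast
  qed
qed (use assms in auto)

text \<open>The neighbours of \<open>u\<close> induce a 2-regular graph. If \<open>u\<close> and the two common neighbours of \<open>u\<close> and
  \<open>v\<close> do not form a triangle, the component \<open>P\<close> below either closes a cycle of length at least 4
  around \<open>u\<close>, which is a K23 minor, or has an odd degree sum.\<close>

lemma common_neighbours_adjacent:
  assumes fin: "finite V" and sym: "symp E" and irr: "irreflp E" and free: "K23_minor_free V E"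
    and two: "\<And>x y. x \<in> V \<Longrightarrow> y \<in> V \<Longrightarrow> E x y \<Longrightarrow> card {w \<in> V. E x w \<and> E y w} = 2"
    and uv: "u \<in> V" "v \<in> V" "E u v" and C: "{w \<in> V. E u w \<and> E v w} = {a, b}" and "a \<noteq> b"
  shows "E a b"
proof (rule ccontr)
  assume nab: "\<not> E a b"
  have E: "E x y \<Longrightarrow> E y x" "\<not> E x x" for x y
    using sym irr by (auto simp: symp_def irreflp_def)
  have ab: "a \<in> V" "b \<in> V" "E u a" "E v a" "E u b" "E v b" using C by auto
  have Ca2: "card {w \<in> V. E u w \<and> E a w} = 2" using two uv ab by blast
  have vC: "v \<in> {w \<in> V. E u w \<and> E a w}" using uv ab E by blast
  obtain c d where "{w \<in> V. E u w \<and> E a w} = {c, d}" "c \<noteq> d"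
    using Ca2 by (auto simp: card_2_iff)
  with vC have "{w \<in> V. E u w \<and> E a w} = {v, d} \<and> d \<noteq> v
      \<or> {w \<in> V. E u w \<and> E a w} = {v, c} \<and> c \<noteq> v"
    by (simp only:) blast
  then obtain a' where Ca: "{w \<in> V. E u w \<and> E a w} = {v, a'}" "a' \<noteq> v"
    by (elim disjE conjE)
  have a': "a' \<in> V" "E u a'" "E a a'" using Ca by auto
  \<comment> \<open>In the graph induced by the neighbours of \<open>u\<close>, the vertex
    \<open>v\<close> has neighbours \<open>a\<close> and \<open>b\<close>, and \<open>a\<close> has
    neighbours \<open>v\<close> and \<open>a'\<close>. \<open>P\<close> will be the component of
    \<open>a'\<close> once \<open>v\<close>, \<open>a\<close> and \<open>b\<close> are
    deleted.\<close>
  define N where "N = {w \<in> V. E u w} - {v, a, b}"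
  have "a' \<in> N" using a' Ca(2) nab E by (auto simp: N_def)
  let ?F = "{M. M \<subseteq> N \<and> a' \<in> M \<and> gconn E M}"
  have "finite N" using fin by (simp add: N_def)
  then have "finite ?F" by simp
  moreover have "{a'} \<in> ?F" using \<open>a' \<in> N\<close> by simp
  ultimately obtain P where P: "P \<in> ?F" and max: "\<forall>M\<in>?F. P \<subseteq> M \<longrightarrow> P = M"
    using finite_has_maximal[of ?F] by (metis (no_types, lifting) empty_iff)
  have PN: "P \<subseteq> N" "a' \<in> P" "gconn E P" using P by auto
  have clos: "y \<in> P" if "x \<in> P" "y \<in> N" "E x y" for x y
  proof -
    have "gconn E (insert y P)" using gconn_insert[OF PN(3) that(1) E(1)[OF that(3)] sym] .
    then show ?thesis using max[rule_format, of "insert y P"] PN that by auto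
  qed
  have uP: "u \<notin> P" "v \<notin> P" "a \<notin> P" "b \<notin> P" using PN(1) E by (auto simp: N_def)
  have PV: "P \<subseteq> V" and PE: "\<And>x. x \<in> P \<Longrightarrow> E u x" using PN(1) by (auto simp: N_def)
  have "\<not> gadj E P {b}"
  proof
    \<comment> \<open>Now \<open>v\<close> and \<open>P\<close> are hubs of a K23 minor with
      \<open>a\<close>, \<open>b\<close> and \<open>u\<close> on the other side.\<close>
    assume Pb: "gadj E P {b}"
    have ne: "u \<noteq> v" "u \<noteq> a" "u \<noteq> b" "v \<noteq> a" "v \<noteq> b" using uv ab E by auto
    show False
      by (rule K23_minor_freeD[OF free, of "{v}" P "{a}" "{b}" "{u}"])
        (use PV PN(2,3) uP uv ab a' Pb ne \<open>a \<noteq> b\<close> E PE in \<open>auto simp: gadj_def\<close>)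
  qed
  then have Pb: "\<not> E x b" if "x \<in> P" for x using that by (auto simp: gadj_def)
  have Pv: "\<not> E x v" if "x \<in> P" for x
  proof
    assume "E x v"
    then have "x \<in> {w \<in> V. E u w \<and> E v w}" using that PV PE E by blast
    then show False using uP that unfolding C by blast
  qed
  have Pa: "x = a'" if "x \<in> P" "E x a" for x
  proof -
    have "x \<in> {w \<in> V. E u w \<and> E a w}" using that PV PE E by blast
    then show ?thesis using uP that unfolding Ca by blast
  qed
  \<comment> \<open>Both common neighbours of \<open>u\<close> and \<open>x\<close> lie in
    \<open>P\<close>, except that \<open>a'\<close> loses \<open>a\<close>. The degree sum over
    \<open>P\<close> is therefore odd.\<close>
  have deg: "card {y \<in> P. E x y} = (if x = a' then 1 else 2)" if x: "x \<in> P" for x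
  proof -
    let ?C = "{w \<in> V. E u w \<and> E x w}"
    have c2: "card ?C = 2" using two[of u x] uv x PV PE by blast
    have sub: "{y \<in> P. E x y} = ?C - {a}"
    proof (intro subset_antisym subsetI)
      fix y assume "y \<in> {y \<in> P. E x y}"
      then show "y \<in> ?C - {a}" using PV PE uP by auto
    next
      fix y assume y: "y \<in> ?C - {a}"
      then have "y \<in> N" using Pb[OF x] Pv[OF x] by (auto simp: N_def)
      then show "y \<in> {y \<in> P. E x y}" using clos[OF x] y by auto
    qed
    show ?thesis
    proof (cases "x = a'")
      case True
      then have "a \<in> ?C" using ab a' E by auto
      then show ?thesis using sub c2 True fin by simp
    next
      case False
      then have "a \<notin> ?C" using Pa[OF x] by blast
      then show ?thesis using sub c2 False by simp
    qed
  qed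
  have finP: "finite P" using PV fin finite_subset by blast
  have "adj_pairs P E = Sigma P (\<lambda>x. {y \<in> P. E x y})" by (auto simp: adj_pairs_def)
  then have "card (adj_pairs P E) = (\<Sum>x\<in>P. card {y \<in> P. E x y})"
    using finP by (simp add: card_SigmaI)
  also have "\<dots> = (\<Sum>x\<in>P. if x = a' then 1 else 2)" by (rule sum.cong) (auto simp: deg)
  also have "\<dots> = 1 + (\<Sum>x\<in>P - {a'}. 2)"
    using finP PN(2) by (simp add: sum.remove[of P a'])
  finally have "odd (card (adj_pairs P E))" by simp
  then show False using even_card_adj_pairs[OF finP sym irr] by blast
qed

text \<open>In terms of edges the bound is \<open>2 * card V - 2\<close>, attained by K4. In a
  minimal counterexample every edge has exactly two common neighbours, which yields a K4;
  contracting that K4 contradicts minimality.\<close>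

lemma card_adj_pairs_K23_minor_free:
  assumes "finite V" "V \<noteq> {}" "symp E" "irreflp E" "K23_minor_free V E"
  shows "card (adj_pairs V E) + 4 \<le> 4 * card V"
  using assms
proof (induction "card V" arbitrary: V E rule: less_induct)
  case less
  note fin = less.prems(1) and sym = less.prems(3) and irr = less.prems(4) and free = less.prems(5)
  have E: "E x y \<Longrightarrow> E y x" "\<not> E x x" for x y
    using sym irr by (auto simp: symp_def irreflp_def)
  show ?case
  proof (rule ccontr)
    assume many: "\<not> ?case"
    have IH: "card (adj_pairs (contract K k ` V) (quotient_adj V E (contract K k))) + 4
        \<le> 4 * (card V + 1 - card K)" if K: "k \<in> K" "K \<subseteq> V" "gconn E K" "2 \<le> card K" for K k
    proof -
      let ?W = "contract K k ` V"
      have fK: "finite K" using K(2) fin finite_subset by blast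
      have "card K \<le> card V" using K(2) fin by (simp add: card_mono)
      moreover have "card ?W = Suc (card (V - K))"
        using contract_image[OF K(1,2)] K(1) fin by simp
      ultimately have W: "card ?W = card V + 1 - card K" "card ?W < card V"
        using card_Diff_subset[OF fK K(2)] K(4) by auto
      show ?thesis
        using less.hyps[of ?W "quotient_adj V E (contract K k)"] W fin less.prems(2)
          symp_quotient_adj[OF sym] K23_minor_free_contract[OF free K(1-3)]
        by (auto simp: irreflp_def quotient_adj_def)
    qed
    have two: "card {w \<in> V. E x w \<and> E y w} = 2" if xy: "x \<in> V" "y \<in> V" "E x y" for x y
    proof -
      have ne: "x \<noteq> y" using xy E by auto
      have "gconn E {x, y}" using gconn_insert[of E "{y}" y x] xy sym by simp
      then have "card (adj_pairs (contract {x, y} x ` V) (quotient_adj V E (contract {x, y} x))) + 4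
          \<le> 4 * (card V - 1)"
        using IH[of x "{x, y}"] xy ne by simp
      moreover have "card V > 0" using xy fin by (auto simp: card_gt_0_iff)
      \<comment> \<open>With at most one common neighbour the contraction loses at most 4 ordered
        pairs, the amount the bound allows for one vertex.\<close>
      ultimately have "card {w \<in> V. E x w \<and> E y w} \<ge> 2"
        using card_adj_pairs_contract_edge[OF fin sym irr xy] many by simp
      then show ?thesis
        using card_common_neighbours_le_2[OF free sym irr xy(1,2) ne] by simp
    qed
    have "adj_pairs V E \<noteq> {}"
    proof
      assume "adj_pairs V E = {}"
      then show False using many less.prems(1,2) card_gt_0_iff[of V] by simp
    qed
    then obtain u v where uv: "u \<in> V" "v \<in> V" "E u v" by (auto simp: adj_pairs_def)
    then obtain a b where C: "{w \<in> V. E u w \<and> E v w} = {a, b}" "a \<noteq> b"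
      using two[OF uv] by (auto simp: card_2_iff)
    have ab: "E a b"
      by (rule common_neighbours_adjacent[OF fin sym irr free two uv C])
    have abV: "a \<in> V" "b \<in> V" "E u a" "E v a" "E u b" "E v b" using C by auto
    let ?K = "{u, v, a, b}"
    have ne: "u \<noteq> v" "u \<noteq> a" "u \<noteq> b" "v \<noteq> a" "v \<noteq> b" using uv abV E by auto
    have cK: "card ?K = 4" using ne C(2) by simp
    have KE: "E x y" if "x \<in> ?K" "y \<in> ?K" "x \<noteq> y" for x y
      using that uv ab abV E(1) by blast
    have KV: "?K \<subseteq> V" using uv abV by auto
    have "gconn E ?K" unfolding gconn_def using KE by blast
    then have "card (adj_pairs (contract ?K u ` V) (quotient_adj V E (contract ?K u))) + 4
        \<le> 4 * (card V + 1 - 4)"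
      using IH[of u ?K] KV cK by simp
    moreover have "card (adj_pairs V E)
        \<le> card (adj_pairs (contract ?K u ` V) (quotient_adj V E (contract ?K u))) + card (adj_pairs ?K E)"
    proof (rule card_adj_pairs_contract_separated[OF fin sym irr KV])
      fix x y w assume *: "x \<in> ?K" "y \<in> ?K" "w \<in> V - ?K" "E x w" "E y w"
      show "x = y"
      proof (rule ccontr)
        assume "x \<noteq> y"
        \<comment> \<open>Otherwise \<open>x\<close> and \<open>y\<close> would have three common
          neighbours: the other two vertices of the K4, and \<open>w\<close>.\<close>
        have "?K - {x, y} \<union> {w} \<subseteq> {w \<in> V. E x w \<and> E y w}"
          using * KE KV by auto
        then have "card (?K - {x, y} \<union> {w}) \<le> card {w \<in> V. E x w \<and> E y w}"
          by (rule card_mono[rotated]) (use fin in simp)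
        also have "\<dots> = 2"
          by (rule two) (use * KV KE[OF *(1,2) \<open>x \<noteq> y\<close>] in blast)+
        finally have "card (?K - {x, y} \<union> {w}) \<le> 2" .
        moreover have "card (?K - {x, y}) = 2"
          using card_Diff_subset[of "{x, y}" ?K] *(1,2) cK \<open>x \<noteq> y\<close> by auto
        moreover have "w \<notin> ?K - {x, y}" using *(3) by blast
        ultimately show False by simp
      qed
    qed simp
    \<comment> \<open>12 ordered pairs are what the bound allows for the three vertices
      lost.\<close>
    moreover have "card (adj_pairs ?K E) \<le> 12"
    proof -
      have "adj_pairs ?K E \<subseteq> ?K \<times> ?K - (\<lambda>x. (x, x)) ` ?K"
        using E(2) by (auto simp: adj_pairs_def)
      then have "card (adj_pairs ?K E) \<le> card (?K \<times> ?K - (\<lambda>x. (x, x)) ` ?K)"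
        by (intro card_mono) auto
      also have "\<dots> = card (?K \<times> ?K) - card ((\<lambda>x. (x, x)) ` ?K)"
        by (intro card_Diff_subset) auto
      also have "card ((\<lambda>x. (x, x)) ` ?K) = card ?K"
        by (intro card_image inj_onI) auto
      finally show ?thesis using cK by (simp only: card_cartesian_product)
    qed
    moreover have "4 \<le> card V" using card_mono[OF fin KV] cK by simp
    ultimately show False using many by simp
  qed
qed

section \<open>Outerplanar graphs have no K23 minor\<close>

lemma connected_arc_minus_end:
  fixes c :: "real \<Rightarrow> 'a::t2_space"
  assumes "arc c" "z = pathstart c \<or> z = pathfinish c"
  shows "connected (path_image c - {z})"
proof -
  have start: "connected (path_image c - {pathstart c})" if c: "arc c" for c :: "real \<Rightarrow> 'a"
  proof -
    have "path_image c - {pathstart c} = c ` {0<..1}"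
    proof -
      have "c t \<noteq> c 0" if "t \<in> {0<..1}" for t
        using c that inj_onD[of c "{0..1}" t 0] by (auto simp: arc_def)
      moreover have "{0..1} = insert 0 {0<..1::real}" by auto
      ultimately show ?thesis
        unfolding path_image_def pathstart_def
        by (metis (no_types, lifting) Diff_insert_absorb image_iff image_insert)
    qed
    moreover have "continuous_on {0<..1} c"
      using c by (auto simp: arc_def path_def intro: continuous_on_subset)
    ultimately show ?thesis
      by (simp add: connected_continuous_image)
  qed
  show ?thesis
    using assms start[of c] start[of "reversepath c"] by (auto simp: arc_reversepath)
qed

text \<open>The vertices reachable from a fixed one admit no cut, and every point on an edge is
  joined to an end of that edge.\<close>

lemma path_connected_drawing:
  assumes emb: "plane_embedding V E p g" and B: "B \<subseteq> V" "gconn E B"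
  shows "path_connected (p ` B \<union> (\<Union>{path_image (g {u, v}) | u v. u \<in> B \<and> v \<in> B \<and> E u v}))"
    (is "path_connected ?W")
proof -
  have cell: "path_component ?W q (p u) \<and> path_component ?W (p u) (p v)"
    if uv: "u \<in> B" "v \<in> B" "E u v" "q \<in> path_image (g {u, v})" for u v q
  proof -
    have "u \<in> V" "v \<in> V" using uv B by auto
    then have arc: "arc (g {u, v})" and
      ends: "{pathstart (g {u, v}), pathfinish (g {u, v})} = {p u, p v}"
      using emb uv unfolding plane_embedding_def by auto
    have "p u \<in> path_image (g {u, v})" "p v \<in> path_image (g {u, v})"
      using ends pathstart_in_path_image[of "g {u, v}"] pathfinish_in_path_image[of "g {u, v}"]
      by (auto simp: doubleton_eq_iff)
    moreover have "path_connected (path_image (g {u, v}))"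
      using arc by (simp add: arc_imp_path path_connected_path_image)
    moreover have "path_image (g {u, v}) \<subseteq> ?W" using uv by blast
    ultimately show ?thesis
      using uv(4) path_component_of_subset unfolding path_connected_component by meson
  qed
  obtain s where s: "s \<in> B" using B by (auto simp: gconn_def)
  define X where "X = {v \<in> B. path_component ?W (p s) (p v)}"
  have "path_component ?W (p s) (p s)"
    using s by (intro path_component_refl) auto
  then have "s \<in> X" using s by (simp add: X_def)
  have "X = B"
  proof (rule ccontr)
    assume "X \<noteq> B"
    then obtain u v where uv: "u \<in> X" "v \<in> B - X" "E u v"
      using gconnD[OF B(2), of X] \<open>s \<in> X\<close> unfolding X_def by blast
    then have "path_image (g {u, v}) \<noteq> {}" by simp
    then have "path_component ?W (p u) (p v)"
      using cell[of u v] uv by (auto simp: X_def)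
    then have "v \<in> X" using uv path_component_trans by (auto simp: X_def)
    then show False using uv by blast
  qed
  have "path_component ?W (p s) q" if q: "q \<in> ?W" for q
  proof -
    have "\<exists>u\<in>B. path_component ?W q (p u)"
    proof (cases "q \<in> p ` B")
      case True
      then obtain u where "u \<in> B" "q = p u" by blast
      then show ?thesis using path_component_refl[OF q] by auto
    next
      case False
      then obtain u v where "u \<in> B" "v \<in> B" "E u v" "q \<in> path_image (g {u, v})"
        using q by blast
      then show ?thesis using cell by blast
    qed
    then obtain u where "u \<in> B" "path_component ?W q (p u)" by blast
    then show ?thesis
      using \<open>X = B\<close> path_component_sym path_component_trans unfolding X_def by blast
  qed
  then show ?thesis
    unfolding path_connected_component by (meson path_component_sym path_component_trans)
qed

text \<open>A K23 minor with single hubs \<open>x\<close> and \<open>y\<close> gives a thick theta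
  curve: \<open>T i\<close> is the drawing of \<open>B i\<close> with one edge to each hub. The
  outer face touches every \<open>T i\<close> at a vertex.\<close>

lemma outerplanar_imp_K23_minor_free:
  assumes G: "simple_graph V E" and op: "outerplanar V E"
  shows "K23_minor_free V E"
proof (rule ccontr)
  have EV: "E u v \<Longrightarrow> u \<in> V" "E u v \<Longrightarrow> v \<in> V" and sym: "E u v \<Longrightarrow> E v u" and fin: "finite V" for u v
    using G unfolding simple_graph_def by blast+
  assume "\<not> K23_minor_free V E"
  then obtain x y B where K: "K23_model V E {x} {y} B"
    using fin sym by (auto simp: symp_def elim!: not_K23_minor_freeE)
  note K' = K23_modelD[OF K]
  obtain p g z where emb: "plane_embedding V E p g"
    and unb: "\<not> bounded (connected_component_set (- drawing V E p g) z)"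
    and fr: "\<forall>v\<in>V. p v \<in> frontier (connected_component_set (- drawing V E p g) z)"
    using op unfolding outerplanar_def by auto
  define U where "U = connected_component_set (- drawing V E p g) z"
  define cell where "cell u v = path_image (g {u, v})" for u v
  have inj: "p u = p v \<longleftrightarrow> u = v" if "u \<in> V" "v \<in> V" for u v
    using emb that inj_on_eq_iff[of p V u v] unfolding plane_embedding_def by blast
  have cell: "arc (g {u, v})" "{pathstart (g {u, v}), pathfinish (g {u, v})} = {p u, p v}"
    "path_image (g {u, v}) \<inter> p ` V = {p u, p v}" if "E u v" for u v
    using emb EV[OF that] that unfolding plane_embedding_def by auto
  have cellV: "w = u \<or> w = v" if "E u v" "w \<in> V" "p w \<in> cell u v" for u v w
  proof -
    have "p w \<in> {p u, p v}" using cell(3)[OF that(1)] that unfolding cell_def by blast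
    then show ?thesis using inj that EV by blast
  qed
  have cells: "cell u v \<inter> cell a b \<subseteq> p ` ({u, v} \<inter> {a, b})"
    if "E u v" "E a b" "{u, v} \<noteq> {a, b}" for u v a b
    using emb EV[OF that(1)] EV[OF that(2)] that unfolding plane_embedding_def cell_def by simp
  have cell_ends: "p u \<in> cell u v" "p v \<in> cell u v" if "E u v" for u v
    using cell(3)[OF that] unfolding cell_def by auto
  have cell_conn: "path_connected (cell u v)" "connected (cell u v - {p u})" if "E u v" for u v
    using cell(1,2)[OF that] connected_arc_minus_end[of "g {u, v}" "p u"]
    by (auto simp: cell_def arc_imp_path path_connected_path_image doubleton_eq_iff)
  have "\<exists>s t. s \<in> B i \<and> t \<in> B i \<and> E x s \<and> E y t" if "i < 3" for i
    using K'(10,11)[OF that] unfolding gadj_def by blast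
  then obtain s t where st: "\<And>i. i < 3 \<Longrightarrow> s i \<in> B i" "\<And>i. i < 3 \<Longrightarrow> t i \<in> B i"
    "\<And>i. i < 3 \<Longrightarrow> E x (s i)" "\<And>i. i < 3 \<Longrightarrow> E y (t i)" by metis
  have xy: "x \<in> V" "y \<in> V" "x \<noteq> y" using K'(1,2,5) by auto
  have B: "x \<notin> B i" "y \<notin> B i" "B i \<subseteq> V" if "i < 3" for i
    using K'(6,8,9)[OF that] by auto
  define W where "W i = p ` B i \<union> (\<Union>{cell u v | u v. u \<in> B i \<and> v \<in> B i \<and> E u v})" for i
  define T where "T i = W i \<union> cell x (s i) \<union> cell y (t i)" for i
  have W: "path_connected (W i)" if "i < 3" for i
    using path_connected_drawing[OF emb B(3) K'(7)] that by (simp add: W_def cell_def)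
  have sW: "p (s i) \<in> W i" "p (t i) \<in> W i" if "i < 3" for i
    using st that by (auto simp: W_def)
  \<comment> \<open>Every edge in \<open>T i\<close> is oriented so that its first end is in
    \<open>B i\<close>. Hence an edge of \<open>T i\<close> and an edge of \<open>T j\<close> are
    distinct and can share only \<open>x\<close> or \<open>y\<close>.\<close>
  have T_cases: "(\<exists>u\<in>B i. q = p u) \<or>
      (\<exists>u v. E u v \<and> u \<in> B i \<and> v \<in> B i \<union> {x, y} \<and> q \<in> cell u v)"
    if "i < 3" "q \<in> T i" for i q
  proof -
    have "cell x (s i) = cell (s i) x" "cell y (t i) = cell (t i) y"
      by (simp_all add: cell_def insert_commute)
    then show ?thesis
      using that(2) st(1,2)[OF that(1)] st(3,4)[OF that(1), THEN sym]
      unfolding T_def W_def by blast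
  qed
  have W_xy: "p x \<notin> W i" "p y \<notin> W i" if "i < 3" for i
    using B[OF that] inj xy cellV unfolding W_def by blast+
  have "T i \<subseteq> drawing V E p g" if "i < 3" for i
  proof
    fix q assume "q \<in> T i"
    from T_cases[OF that this] show "q \<in> drawing V E p g"
      using B[OF that] EV unfolding drawing_def cell_def by blast
  qed
  then have UT: "U \<inter> T i = {}" if "i < 3" for i
    using that connected_component_subset[of "- drawing V E p g" z] unfolding U_def by blast
  \<comment> \<open>Each hub lies on one edge of \<open>T i\<close> only and is an end of it, so its
    deletion does not disconnect \<open>T i\<close>.\<close>
  have Tminus: "T i - {p x, p y} = W i \<union> (cell x (s i) - {p x}) \<union> (cell y (t i) - {p y})"
    if i: "i < 3" for i
  proof -
    have "p x \<notin> cell y (t i)" "p y \<notin> cell x (s i)"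
      using cellV[OF st(4)[OF i], of x] cellV[OF st(3)[OF i], of y] xy B[OF i] st(1,2)[OF i] by auto
    then show ?thesis using W_xy[OF i] unfolding T_def by blast
  qed
  show False
  proof (rule thick_theta_not_touched_by_face[of "p x" "p y" T U])
    show "p x \<noteq> p y" using xy inj by simp
    fix i :: nat assume i: "i < 3"
    have sx: "p (s i) \<in> cell x (s i)" "p (t i) \<in> cell y (t i)"
      using cell_ends st i by auto
    show "path_connected (T i)"
      unfolding T_def using sx sW[OF i] W[OF i] cell_conn(1) st(3,4)[OF i]
      by (intro path_connected_Un) auto
    show "p x \<in> T i" "p y \<in> T i"
      using cell_ends(1) st(3,4)[OF i] by (auto simp: T_def)
    have ne: "p (s i) \<noteq> p x" "p (t i) \<noteq> p y"
      using W_xy[OF i] sW[OF i] by auto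
    show "connected (T i - {p x, p y})"
      unfolding Tminus[OF i]
      using sx ne sW[OF i] path_connected_imp_connected[OF W[OF i]] cell_conn(2) st(3,4)[OF i]
      by (intro connected_Un) auto
    show "U \<inter> T i = {}" by (rule UT[OF i])
    \<comment> \<open>Outerplanarity enters here: the vertex \<open>s i\<close> is on the boundary
      of the outer face and is not a hub.\<close>
    have "p (s i) \<in> closure U"
      using fr[rule_format, of "s i"] st(1)[OF i] B[OF i] unfolding U_def frontier_def by blast
    moreover have "p (s i) \<in> T i - {p x, p y}" unfolding Tminus[OF i] using sW[OF i] by blast
    ultimately show "closure U \<inter> (T i - {p x, p y}) \<noteq> {}" by blast
    fix j :: nat assume j: "j < 3" "i \<noteq> j"
    have dis: "B i \<inter> B j = {}" by (rule K'(12)[OF i j])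
    show "T i \<inter> T j \<subseteq> {p x, p y}"
    proof
      fix q assume q: "q \<in> T i \<inter> T j"
      consider u w where "u \<in> B i" "w \<in> B j" "q = p u" "q = p w"
        | u a b where "u \<in> B i" "q = p u" "E a b" "a \<in> B j" "b \<in> B j \<union> {x, y}" "q \<in> cell a b"
        | u a b where "u \<in> B j" "q = p u" "E a b" "a \<in> B i" "b \<in> B i \<union> {x, y}" "q \<in> cell a b"
        | u v a b where "E u v" "u \<in> B i" "v \<in> B i \<union> {x, y}" "q \<in> cell u v"
            "E a b" "a \<in> B j" "b \<in> B j \<union> {x, y}" "q \<in> cell a b"
        using T_cases[OF i, of q] T_cases[OF j(1), of q] q by blast
      then show "q \<in> {p x, p y}"
      proof cases
        case 1
        then have "u = w" using inj B[OF i] B[OF j(1)] by blast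
        then show ?thesis using 1 dis by blast
      next
        case 2
        then have "u = a \<or> u = b" using cellV B[OF i] by blast
        then show ?thesis using 2 dis by blast
      next
        case 3
        then have "u = a \<or> u = b" using cellV B[OF j(1)] by blast
        then show ?thesis using 3 dis by blast
      next
        case 4
        have "u \<notin> {a, b}" using 4 dis B[OF i] by blast
        then have "q \<in> p ` ({u, v} \<inter> {a, b})" using cells[of u v a b] 4 by blast
        moreover have "{u, v} \<inter> {a, b} \<subseteq> {x, y}" using 4 dis B[OF i] B[OF j(1)] by blast
        ultimately show ?thesis by blast
      qed
    qed
  next
    show "connected U" by (simp add: U_def)
    show "\<not> bounded U" using unb by (simp add: U_def)
  qed
qed

section \<open>The algorithm\<close>

text \<open>The witnesses \<open>u\<close> and \<open>u'\<close> may lie outside the graph; such a witness dominates nothing.\<close>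

definition heavy :: "('a \<Rightarrow> 'a \<Rightarrow> bool) \<Rightarrow> 'a \<Rightarrow> bool" where
  "heavy E v \<longleftrightarrow> \<not> (\<exists>u u'. u \<noteq> v \<and> u' \<noteq> v \<and> (\<forall>w. E v w \<longrightarrow> w = u \<or> w = u' \<or> E w u \<or> E w u'))"

definition selected :: "('a \<Rightarrow> 'a \<Rightarrow> bool) \<Rightarrow> 'a \<Rightarrow> bool" where
  "selected E v \<longleftrightarrow> heavy E v \<or> (\<forall>w. E v w \<longrightarrow> \<not> heavy E w)"

text \<open>Heaviness depends only on the edges at \<open>v\<close> and at its neighbours. The
  witnesses range over the whole type, so a restricted view does not change their supply.\<close>

lemma heavy_cong:
  assumes "\<And>x. E' v x = E v x" "\<And>x y. E v x \<Longrightarrow> E' x y = E x y"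
  shows "heavy E' v = heavy E v"
proof -
  have "(\<forall>w. E' v w \<longrightarrow> w = u \<or> w = u' \<or> E' w u \<or> E' w u')
      = (\<forall>w. E v w \<longrightarrow> w = u \<or> w = u' \<or> E w u \<or> E w u')" for u u'
    using assms by auto
  then show ?thesis unfolding heavy_def by simp
qed

lemma gball_mono: "gball V E v r \<subseteq> gball V E v (Suc r)"
  by auto

lemma gball_step: "\<lbrakk>x \<in> gball V E v r; E x y; y \<in> V\<rbrakk> \<Longrightarrow> y \<in> gball V E v (Suc r)"
  by auto

text \<open>Selection asks for the heaviness of neighbours, hence for the edges at vertices of
  distance 2; their other ends have distance at most 3.\<close>

lemma local_output_selected:
  assumes EV: "\<And>x y. E x y \<Longrightarrow> y \<in> V"
  shows "local_output (\<lambda>(_, E', v). selected E' v) 3 V E = {v \<in> V. selected E v}"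
proof -
  have "selected (\<lambda>x y. x \<in> gball V E v 3 \<and> y \<in> gball V E v 3 \<and> E x y) v = selected E v" for v
  proof -
    define G where "G = gball V E v"
    let ?E = "\<lambda>x y. x \<in> G 3 \<and> y \<in> G 3 \<and> E x y"
    have Suc: "G 1 \<subseteq> G 2" "G 2 \<subseteq> G 3" "G 0 \<subseteq> G 1"
      using gball_mono[of V E v 0] gball_mono[of V E v 1] gball_mono[of V E v 2]
      unfolding G_def by (simp_all only: One_nat_def numeral_2_eq_2 numeral_3_eq_3)
    have step: "E x y \<Longrightarrow> x \<in> G r \<Longrightarrow> y \<in> G (Suc r)" for x y r
      using EV unfolding G_def by (intro gball_step)
    have agree: "?E x y = E x y" if "x \<in> G 2" for x y
      using that step[of x y 2] Suc by auto
    have heavy: "heavy ?E x = heavy E x" if "x \<in> G 1" for x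
    proof (rule heavy_cong)
      show "?E x y = E x y" for y using that Suc by (intro agree) auto
      show "?E y z = E y z" if "E x y" for y z
        using step[OF that \<open>x \<in> G 1\<close>] by (intro agree) (simp add: numeral_2_eq_2)
    qed
    have "v \<in> G 0" by (simp add: G_def)
    then have "v \<in> G 1" "v \<in> G 2" and N: "\<And>w. E v w \<Longrightarrow> w \<in> G 1"
      using Suc step[of v _ 0] by auto
    then have "selected ?E v = selected E v"
      unfolding selected_def agree[OF \<open>v \<in> G 2\<close>] using heavy by blast
    then show ?thesis by (simp add: G_def)
  qed
  then show ?thesis by (simp add: local_output_def local_view_def)
qed

text \<open>An unselected vertex has a heavy neighbour, and heavy vertices are selected.\<close>

lemma dominating_set_selected:
  assumes "\<And>x y. E x y \<Longrightarrow> y \<in> V"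
  shows "dominating_set V E {v \<in> V. selected E v}"
  using assms unfolding dominating_set_def selected_def by blast

text \<open>Each of the two witnesses accounts for itself and at most two common neighbours with
  \<open>d\<close>, so the total is \<open>1 + 3 + 3\<close>.\<close>

lemma card_closed_neighbourhood_not_heavy:
  assumes fin: "finite V" and sym: "symp E" and irr: "irreflp E" and free: "K23_minor_free V E"
    and EV: "\<And>x y. E x y \<Longrightarrow> x \<in> V" and d: "d \<in> V" "\<not> heavy E d"
  shows "card (insert d {v. E d v}) \<le> 7"
proof -
  have E: "E x y \<Longrightarrow> E y x" for x y using sym by (auto simp: symp_def)
  obtain u u' where u: "u \<noteq> d" "u' \<noteq> d" "\<And>w. E d w \<Longrightarrow> w = u \<or> w = u' \<or> E w u \<or> E w u'"
    using d(2) unfolding heavy_def by blast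
  let ?C = "\<lambda>u. insert u {w \<in> V. E d w \<and> E u w}"
  have C: "card (?C u) \<le> 3" if "u \<noteq> d" for u
  proof -
    have "card {w \<in> V. E d w \<and> E u w} \<le> 2"
    proof (cases "u \<in> V")
      case True
      then show ?thesis using card_common_neighbours_le_2[OF free sym irr d(1) True] that by auto
    next
      case False
      then have "{w \<in> V. E d w \<and> E u w} = {}" using EV by auto
      then show ?thesis by (simp only: card.empty)
    qed
    then show ?thesis using fin by (simp add: card_insert_if)
  qed
  have "insert d {v. E d v} \<subseteq> insert d (?C u \<union> ?C u')"
    using u(3) E EV by blast
  then have "card (insert d {v. E d v}) \<le> card (insert d (?C u \<union> ?C u'))"
    using fin by (intro card_mono) auto
  also have "\<dots> \<le> Suc (card (?C u \<union> ?C u'))"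
    by (rule card_insert_le_m1) auto
  also have "\<dots> \<le> Suc (card (?C u) + card (?C u'))" using card_Un_le by blast
  finally show ?thesis using C[OF u(1)] C[OF u(2)] by linarith
qed

section \<open>Charging the selected vertices to the bags of a dominating set\<close>

lemma gconn_star:
  assumes "d \<in> S" "symp E" "\<And>v. v \<in> S \<Longrightarrow> v \<noteq> d \<Longrightarrow> E v d"
  shows "gconn E S"
  unfolding gconn_def
proof (intro conjI allI impI)
  fix X assume X: "X \<subseteq> S" "X \<noteq> {}" "X \<noteq> S"
  show "\<exists>x\<in>X. \<exists>y\<in>S - X. E x y"
  proof (cases "d \<in> X")
    case True
    then obtain y where "y \<in> S - X" using X by blast
    then show ?thesis using True assms by (metis DiffD1 DiffD2 sympD)
  next
    case False
    then show ?thesis using X assms by blast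
  qed
qed (use assms in auto)

lemma card_selected_le:
  assumes fin: "finite V" and sym: "symp E" and irr: "irreflp E" and free: "K23_minor_free V E"
    and EV: "\<And>x y. E x y \<Longrightarrow> x \<in> V" and D: "dominating_set V E D"
  shows "card {v \<in> V. selected E v} \<le> 8 * card D"
proof -
  have E: "E x y \<Longrightarrow> E y x" "\<not> E x x" for x y
    using sym irr by (auto simp: symp_def irreflp_def)
  have EV2: "E x y \<Longrightarrow> y \<in> V" for x y using EV E by blast
  have DV: "D \<subseteq> V" using D by (simp add: dominating_set_def)
  have finD: "finite D" using DV fin finite_subset by blast
  have "\<exists>d\<in>D. (v \<in> D \<longrightarrow> d = v) \<and> (v \<notin> D \<longrightarrow> E v d)" if "v \<in> V" for v
    using D that unfolding dominating_set_def by (cases "v \<in> D") auto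
  then obtain f where f: "\<And>v. v \<in> V \<Longrightarrow> f v \<in> D" "\<And>v. v \<in> D \<Longrightarrow> f v = v"
    "\<And>v. v \<in> V \<Longrightarrow> v \<notin> D \<Longrightarrow> E v (f v)"
    using DV by (metis subsetD)
  have fV: "f ` V = D" using f DV by force
  let ?bag = "\<lambda>d. {v \<in> V. f v = d}"
  have bag: "gconn E (?bag d)" if "d \<in> D" for d
  proof (rule gconn_star[of d])
    show "d \<in> ?bag d" using that f(2) DV by auto
    show "E v d" if "v \<in> ?bag d" "v \<noteq> d" for v
      using that f(2)[of v] f(3)[of v] by auto
  qed (rule sym)
  define H where "H = quotient_adj V E f"
  have freeH: "K23_minor_free D H"
    using K23_minor_free_quotient[OF free, of f] bag unfolding fV H_def by blast
  have symH: "symp H" unfolding H_def using symp_quotient_adj[OF sym] .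
  have irrH: "irreflp H" by (auto simp: H_def quotient_adj_def irreflp_def)
  \<comment> \<open>The additive gain of the density bound is given up so that the empty
    \<open>W\<close> is covered.\<close>
  have boundH: "card (adj_pairs W H) \<le> 4 * card W" if "W \<subseteq> D" for W
  proof (cases "W = {}")
    case False
    then have "card (adj_pairs W H) + 4 \<le> 4 * card W"
      using that finD by (intro card_adj_pairs_K23_minor_free K23_minor_free_subset[OF that freeH]
          symH irrH) (auto intro: finite_subset)
    then show ?thesis by simp
  qed (simp add: adj_pairs_def)

  define X where "X = {x \<in> V - D. heavy E x}"
  define ext where "ext x = {d \<in> D. d \<noteq> f x \<and> (\<exists>y. E x y \<and> f y = d)}" for x
  have finX: "finite X" and finext: "finite (ext x)" for x
    using fin finD by (auto simp: X_def ext_def)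
  have ext2: "2 \<le> card (ext x)" if x: "x \<in> X" for x
  proof -
    have xV: "x \<in> V" "x \<notin> D" and hx: "heavy E x" using x by (auto simp: X_def)
    \<comment> \<open>Members of \<open>D\<close> differ from \<open>x\<close>, so they are
      admissible as witnesses. A neighbour of \<open>x\<close> that they leave undominated belongs
      to neither bag.\<close>
    have far: "\<exists>y. E x y \<and> f y \<noteq> d \<and> f y \<noteq> d'" if "d \<in> D" "d' \<in> D" for d d'
    proof -
      have "d \<noteq> x" "d' \<noteq> x" using that xV by auto
      then obtain w where w: "E x w" "w \<noteq> d" "w \<noteq> d'" "\<not> E w d" "\<not> E w d'"
        using hx unfolding heavy_def by blast
      have "f w \<noteq> d" "f w \<noteq> d'" using w f(2,3) EV2[OF w(1)] by metis+
      then show ?thesis using w(1) by blast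
    qed
    have fx: "f x \<in> D" using f(1) xV by blast
    obtain y where y: "E x y" "f y \<noteq> f x" using far[OF fx fx] by blast
    have fy: "f y \<in> D" using f(1) EV2[OF y(1)] by blast
    obtain z where z: "E x z" "f z \<noteq> f x" "f z \<noteq> f y" using far[OF fx fy] by blast
    have "{f y, f z} \<subseteq> ext x"
      using y z fy f(1)[OF EV2[OF z(1)]] unfolding ext_def by auto
    then have "card {f y, f z} \<le> card (ext x)" by (rule card_mono[OF finext])
    then show ?thesis using z(3) by simp
  qed
  \<comment> \<open>The heavy leaves of bag \<open>d\<close> with a neighbour in bag
    \<open>d'\<close>. Three of them would form a K23 minor with the hubs \<open>{d}\<close> and bag
    \<open>d'\<close>.\<close>
  define Q where "Q d d' = {x \<in> X. f x = d \<and> d' \<in> ext x}" for d d'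
  have Q2: "card (Q d d') \<le> 2" if d: "d \<in> D" "d' \<in> D" for d d'
  proof (rule ccontr)
    assume "\<not> ?thesis"
    then obtain a b c where abc: "a \<in> Q d d'" "b \<in> Q d d'" "c \<in> Q d d'" "a \<noteq> b" "a \<noteq> c" "b \<noteq> c"
      by (rule card_ge_3E)
    have q: "x \<in> V" "x \<noteq> d" "f x = d" "d' \<noteq> d" "gadj E {d} {x}" "gadj E (?bag d') {x}"
      if xQ: "x \<in> Q d d'" for x
    proof -
      show 1: "x \<in> V" "x \<noteq> d" "f x = d" "d' \<noteq> d"
        using that d by (auto simp: Q_def X_def ext_def)
      show "gadj E {d} {x}"
        using that f(3)[of x] E unfolding gadj_def Q_def X_def by auto
      obtain y where "E x y" "f y = d'" using xQ by (auto simp: Q_def ext_def)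
      then show "gadj E (?bag d') {x}" using E(1) EV2 unfolding gadj_def by blast
    qed
    note qa = q[OF abc(1)] and qb = q[OF abc(2)] and qc = q[OF abc(3)]
    show False
      by (rule K23_minor_freeD[OF free, of "{d}" "?bag d'" "{a}" "{b}" "{c}"])
        (use qa qb qc abc(4-6) bag[OF d(2)] d DV f(2)[OF d(1)] in auto)
  qed
  have QH: "H d d'" if "x \<in> Q d d'" for x d d'
    using that EV2 unfolding Q_def X_def ext_def H_def quotient_adj_def by blast

  define Dh where "Dh = {d \<in> D. heavy E d}"
  define Xh where "Xh = {x \<in> X. f x \<in> Dh}"
  define L where "L = {d' \<in> D - Dh. \<exists>d\<in>Dh. Q d d' \<noteq> {}}"
  \<comment> \<open>Ordered pairs of a heavy \<open>d\<close> and a bag reached by a heavy leaf of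
    \<open>d\<close>; \<open>PL\<close> is the part that ends in \<open>L\<close>.\<close>
  define PR where "PR = {(d, d'). d \<in> Dh \<and> d' \<in> D \<and> Q d d' \<noteq> {}}"
  define PL where "PL = {(d, d'). d \<in> Dh \<and> d' \<in> L \<and> Q d d' \<noteq> {}}"
  have DhD: "Dh \<subseteq> D" and LD: "L \<subseteq> D" and DhL: "Dh \<inter> L = {}"
    by (auto simp: Dh_def L_def)
  have finDh: "finite Dh" and finL: "finite L" using DhD LD finD finite_subset by blast+
  have finPR: "finite PR"
    by (rule finite_subset[of _ "Dh \<times> D"]) (use finDh finD in \<open>auto simp: PR_def\<close>)
  have finPL: "finite PL"
    by (rule finite_subset[of _ "Dh \<times> L"]) (use finDh finL in \<open>auto simp: PL_def\<close>)
  have finXh: "finite Xh" using finX by (simp add: Xh_def)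

  \<comment> \<open>Double counting of leaves and reached bags: every leaf in \<open>Xh\<close>
    reaches at least two bags, and every pair in \<open>PR\<close> is realised by at most two
    leaves.\<close>
  have "card Xh \<le> card PR"
  proof -
    have "2 * card Xh = (\<Sum>x\<in>Xh. 2)" by simp
    also have "\<dots> \<le> (\<Sum>x\<in>Xh. card (ext x))" by (rule sum_mono) (auto simp: Xh_def ext2)
    also have "\<dots> = card (Sigma Xh ext)" using finXh finext by (simp add: card_SigmaI)
    also have "\<dots> \<le> card (\<Union>(d, d')\<in>PR. Q d d' \<times> {d'})"
    proof (rule card_mono)
      show "finite (\<Union>(d, d')\<in>PR. Q d d' \<times> {d'})"
        using finPR finX by (auto simp: Q_def)
      show "Sigma Xh ext \<subseteq> (\<Union>(d, d')\<in>PR. Q d d' \<times> {d'})"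
        unfolding Xh_def PR_def Q_def ext_def by fastforce
    qed
    also have "\<dots> \<le> (\<Sum>(d, d')\<in>PR. card (Q d d' \<times> {d'}))"
      using card_UN_le[OF finPR, of "\<lambda>(d, d'). Q d d' \<times> {d'}"] by (simp add: case_prod_unfold)
    also have "\<dots> \<le> (\<Sum>p\<in>PR. 2)"
      using Q2 DhD by (intro sum_mono) (auto simp: PR_def card_cartesian_product)
    finally show ?thesis by simp
  qed
  moreover have "card PR \<le> card (adj_pairs Dh H) + card PL"
  proof -
    have "PR \<subseteq> adj_pairs Dh H \<union> PL"
      using QH by (auto simp: PR_def PL_def L_def adj_pairs_def)
    then have "card PR \<le> card (adj_pairs Dh H \<union> PL)"
      by (rule card_mono[rotated]) (use finDh finPL in simp)
    then show ?thesis using card_Un_le order_trans by blast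
  qed
  moreover have "card (adj_pairs Dh H) + 2 * card PL \<le> 4 * (card Dh + card L)"
  proof -
    \<comment> \<open>A pair in \<open>PL\<close> is counted together with its converse, which
      explains the factor 2.\<close>
    have "adj_pairs Dh H \<union> (PL \<union> PL\<inverse>) \<subseteq> adj_pairs (Dh \<union> L) H"
      using QH symH by (auto simp: PL_def adj_pairs_def symp_def)
    then have "card (adj_pairs Dh H \<union> (PL \<union> PL\<inverse>)) \<le> card (adj_pairs (Dh \<union> L) H)"
      using finDh finL by (intro card_mono) auto
    moreover have "card (adj_pairs Dh H \<union> (PL \<union> PL\<inverse>)) = card (adj_pairs Dh H) + (card PL + card (PL\<inverse>))"
    proof -
      have "PL \<inter> PL\<inverse> = {}" "adj_pairs Dh H \<inter> (PL \<union> PL\<inverse>) = {}"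
        using DhL by (auto simp: PL_def adj_pairs_def)
      then show ?thesis using finPL finDh by (simp add: card_Un_disjoint)
    qed
    moreover have "card (adj_pairs (Dh \<union> L) H) \<le> 4 * card (Dh \<union> L)"
      using boundH DhD LD by simp
    moreover have "card (Dh \<union> L) = card Dh + card L"
      using DhL finDh finL by (simp add: card_Un_disjoint)
    ultimately show ?thesis by (simp add: card_inverse)
  qed
  \<comment> \<open>The density bound is used twice. With \<open>e\<close> for
    \<open>card (adj_pairs Dh H)\<close>, twice \<open>card PR\<close> is at most
    \<open>e + (e + 2 * card PL)\<close>, where \<open>Dh\<close> alone bounds the first
    \<open>e\<close> and \<open>Dh \<union> L\<close> the bracket.\<close>
  moreover have "card (adj_pairs Dh H) \<le> 4 * card Dh" using boundH DhD by blast
  ultimately have "2 * card Xh \<le> 8 * card Dh + 4 * card L" by simp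
  then have Xh: "card Xh \<le> 4 * card Dh + 2 * card L" by simp

  define F where "F d = {v \<in> V. selected E v \<and> f v = d}" for d
  have FN: "F d \<subseteq> insert d {v. E d v}" for d
  proof
    fix v assume "v \<in> F d"
    then have "v \<in> V" "f v = d" by (auto simp: F_def)
    then show "v \<in> insert d {v. E d v}"
      using f(2)[of v] f(3)[of v] E(1)[of v d] by (cases "v \<in> D") auto
  qed
  have light: "card (insert d {v. E d v}) \<le> 7" if "d \<in> D - Dh" for d
    by (rule card_closed_neighbourhood_not_heavy[OF fin sym irr free])
      (use that DV EV in \<open>auto simp: Dh_def\<close>)
  have finN: "finite (insert d {v. E d v})" for d
    by (rule finite_subset[of _ "insert d V"]) (use EV2 fin in auto)
  have F7: "card (F d) \<le> 7" if "d \<in> D - Dh - L" for d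
    using card_mono[OF finN FN, of d] light[of d] that by auto
  have F6: "card (F d) \<le> 6" if d: "d \<in> L" for d
  proof -
    obtain c x where x: "x \<in> Q c d" using d by (auto simp: L_def)
    then obtain z where z: "E x z" "f z = d" and hx: "heavy E x"
      by (auto simp: Q_def X_def ext_def)
    have zN: "z \<in> insert d {v. E d v}" using f(2,3)[of z] z EV2[OF z(1)] E(1) by (cases "z \<in> D") auto
    have nd: "\<not> heavy E d" using d by (auto simp: L_def Dh_def)
    \<comment> \<open>If \<open>z\<close> is selected it must be heavy, because its neighbour
      \<open>x\<close> is. Then \<open>d\<close> is not heavy but has the heavy neighbour
      \<open>z\<close>, so \<open>d\<close> itself is not selected.\<close>
    have "\<exists>y\<in>insert d {v. E d v}. y \<notin> F d"
    proof (cases "z \<in> F d")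
      case True
      then have "heavy E z" using z(1) hx E(1) by (auto simp: F_def selected_def)
      moreover have "E d z" using zN nd \<open>heavy E z\<close> by auto
      ultimately have "d \<notin> F d" using nd by (auto simp: F_def selected_def)
      then show ?thesis by blast
    qed (use zN in blast)
    then have "F d \<subset> insert d {v. E d v}" using FN by blast
    then have "card (F d) < card (insert d {v. E d v})" by (rule psubset_card_mono[OF finN])
    then show ?thesis using light[of d] d by (auto simp: L_def)
  qed
  have "{v \<in> V. selected E v} \<subseteq> (Dh \<union> Xh) \<union> ((\<Union>d\<in>L. F d) \<union> (\<Union>d\<in>D - Dh - L. F d))"
  proof
    fix v assume v: "v \<in> {v \<in> V. selected E v}"
    show "v \<in> (Dh \<union> Xh) \<union> ((\<Union>d\<in>L. F d) \<union> (\<Union>d\<in>D - Dh - L. F d))"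
    proof (cases "f v \<in> Dh")
      case True
      show ?thesis
      proof (cases "v \<in> D")
        case True
        then show ?thesis using \<open>f v \<in> Dh\<close> f(2) by simp
      next
        case False
        then have "E v (f v)" using f(3) v by blast
        \<comment> \<open>A selected leaf next to a heavy centre can only have been selected for
          being heavy.\<close>
        then have "heavy E v" using v True by (auto simp: selected_def Dh_def)
        then show ?thesis using v True False by (simp add: Xh_def X_def)
      qed
    next
      case False
      then show ?thesis using f(1)[of v] v by (auto simp: F_def)
    qed
  qed
  then have "card {v \<in> V. selected E v}
      \<le> card ((Dh \<union> Xh) \<union> ((\<Union>d\<in>L. F d) \<union> (\<Union>d\<in>D - Dh - L. F d)))"
    by (rule card_mono[rotated]) (use finDh finXh finL finD fin in \<open>auto simp: F_def\<close>)
  also have "\<dots> \<le> (card Dh + card Xh) + (card (\<Union>d\<in>L. F d) + card (\<Union>d\<in>D - Dh - L. F d))"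
    by (intro order_trans[OF card_Un_le] add_mono card_Un_le)
  also have "card (\<Union>d\<in>L. F d) \<le> 6 * card L"
    using card_UN_le[OF finL, of F] sum_mono[of L "\<lambda>d. card (F d)" "\<lambda>_. 6"] F6 by fastforce
  also have "card (\<Union>d\<in>D - Dh - L. F d) \<le> 7 * card (D - Dh - L)"
    using card_UN_le[of "D - Dh - L" F] sum_mono[of "D - Dh - L" "\<lambda>d. card (F d)" "\<lambda>_. 7"] F7 finD
    by fastforce
  finally have "card {v \<in> V. selected E v}
      \<le> (card Dh + card Xh) + (6 * card L + 7 * card (D - Dh - L))" by simp
  moreover have "card D = card Dh + (card L + card (D - Dh - L))"
  proof -
    have "D = Dh \<union> (L \<union> (D - Dh - L))" using DhD LD by auto
    then have "card D = card (Dh \<union> (L \<union> (D - Dh - L)))" by simp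
    also have "\<dots> = card Dh + card (L \<union> (D - Dh - L))"
      using DhL finDh finL finD by (intro card_Un_disjoint) auto
    also have "card (L \<union> (D - Dh - L)) = card L + card (D - Dh - L)"
      using finL finD by (intro card_Un_disjoint) auto
    finally show ?thesis .
  qed
  ultimately show ?thesis using Xh by linarith
qed

theorem theorem7:
  fixes \<epsilon> :: real
  assumes "\<epsilon> > 0"
  shows "\<exists>(r::nat) (A :: nat set \<times> (nat \<Rightarrow> nat \<Rightarrow> bool) \<times> nat \<Rightarrow> bool).
           \<forall>V E. simple_graph V E \<and> outerplanar V E \<longrightarrow>
             dominating_set V E (local_output A r V E) \<and>
             real (card (local_output A r V E)) \<le> (8 + \<epsilon>) * real (domination_number V E)"
proof (intro exI allI impI)
  fix V :: "nat set" and E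
  let ?A = "\<lambda>(_ :: nat set, E', v). selected E' v"
  assume G: "simple_graph V E \<and> outerplanar V E"
  then have fin: "finite V" and EV: "\<And>x y. E x y \<Longrightarrow> x \<in> V" "\<And>x y. E x y \<Longrightarrow> y \<in> V"
    and sym: "symp E" and irr: "irreflp E"
    unfolding simple_graph_def symp_def irreflp_def by blast+
  have out: "local_output ?A 3 V E = {v \<in> V. selected E v}"
    by (rule local_output_selected) (erule EV(2))
  \<comment> \<open>The minimum is attained, as the family of dominating sets is finite and contains
    \<open>V\<close>.\<close>
  have "{card D | D. dominating_set V E D} = card ` {D. dominating_set V E D}" by auto
  moreover have "finite {D. dominating_set V E D}"
    by (rule finite_subset[of _ "Pow V"]) (use fin in \<open>auto simp: dominating_set_def\<close>)
  moreover have "V \<in> {D. dominating_set V E D}" by (simp add: dominating_set_def)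
  ultimately have "domination_number V E \<in> card ` {D. dominating_set V E D}"
    unfolding domination_number_def by (metis Min_in empty_iff finite_imageI image_is_empty)
  then obtain D where D: "dominating_set V E D" "domination_number V E = card D" by auto
  have free: "K23_minor_free V E" using outerplanar_imp_K23_minor_free G by blast
  have "card (local_output ?A 3 V E) \<le> 8 * domination_number V E"
    unfolding out D(2) by (rule card_selected_le[OF fin sym irr free _ D(1)]) (erule EV(1))
  then have "real (card (local_output ?A 3 V E)) \<le> 8 * real (domination_number V E)"
    by (metis of_nat_le_iff of_nat_mult of_nat_numeral)
  also have "\<dots> \<le> (8 + \<epsilon>) * real (domination_number V E)"
    using assms by (intro mult_right_mono) auto
  finally have "real (card (local_output ?A 3 V E)) \<le> (8 + \<epsilon>) * real (domination_number V E)" .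
  moreover have "dominating_set V E (local_output ?A 3 V E)"
    unfolding out by (rule dominating_set_selected) (erule EV(2))
  ultimately show "dominating_set V E (local_output ?A 3 V E) \<and>
      real (card (local_output ?A 3 V E)) \<le> (8 + \<epsilon>) * real (domination_number V E)" by blast
qed

end
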